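(* Let $T$ be a locally compact tree with edges of unit length. Then there is an isometric embedding of $T$ into the Cayley graph of the free group $\mathbf{F}_2$ on two generators with the biinvariant word metric associated with the standard generators.
   Context: Let $a,b$ be the standard generators of $\mathbf{F}_2$, $S=\{a^{\pm1},b^{\pm1}\}$, and let $\overline S$ be the set of all conjugates in $\mathbf{F}_2$ of elements of $S$. The biinvariant word norm is $\|g\|=\min\{k\ge 0 : g=s_1\cdots s_k,\ s_i\in\overline S\}$, and the biinvariant word metric is $\mathbf{d}(g,h)=\|gh^{-1}\|$. The biinvariant Cayley graph is the graph with vertex set $\mathbf{F}_2$ and edges of unit length joining $g,h$ whenever $gh^{-1}\in\overline S$, with its path metric, which restricts to $\mathbf{d}$ on vertices. The tree $T$ carries its path metric; vertices are sent to vertices. *)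

theory Defs
  imports "HOL-Analysis.Analysis" "HOL-Algebra.Group"
begin

section \<open>Graphs, trees and their metric realizations\<close>

definition simple_graph :: "'v set \<Rightarrow> 'v set set \<Rightarrow> bool" where
  "simple_graph V E \<longleftrightarrow> (\<forall>e\<in>E. e \<subseteq> V \<and> card e = 2)"

definition adj :: "'v set set \<Rightarrow> 'v \<Rightarrow> 'v \<Rightarrow> bool" where
  "adj E u v \<longleftrightarrow> {u, v} \<in> E"

definition connected_graph :: "'v set \<Rightarrow> 'v set set \<Rightarrow> bool" where
  "connected_graph V E \<longleftrightarrow> V \<noteq> {} \<and> simple_graph V E \<and> (\<forall>u\<in>V. \<forall>v\<in>V. (adj E)\<^sup>*\<^sup>* u v)"

definition acyclic_graph :: "'v set set \<Rightarrow> bool" where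
  "acyclic_graph E \<longleftrightarrow>
     \<not> (\<exists>vs. length vs \<ge> 3 \<and> distinct vs \<and> successively (adj E) vs \<and> adj E (last vs) (hd vs))"

definition tree_graph :: "'v set \<Rightarrow> 'v set set \<Rightarrow> bool" where
  "tree_graph V E \<longleftrightarrow> connected_graph V E \<and> acyclic_graph E"

text \<open>The points of the realization are given by barycentric coordinates: a point of the edge
  \<open>{u, v}\<close> at distance \<open>t\<close> from \<open>u\<close> is the function with value \<open>1 - t\<close> at \<open>u\<close>, \<open>t\<close> at \<open>v\<close>, and
  \<open>0\<close> elsewhere.\<close>

definition simplex_on :: "'v set \<Rightarrow> ('v \<Rightarrow> real) set" where
  "simplex_on c = {p. (\<forall>v. 0 \<le> p v) \<and> (\<forall>v. v \<notin> c \<longrightarrow> p v = 0) \<and> (\<Sum>v\<in>c. p v) = 1}"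

definition cells :: "'v set \<Rightarrow> 'v set set \<Rightarrow> 'v set set" where
  "cells V E = (\<lambda>v. {v}) ` V \<union> E"

definition realization :: "'v set \<Rightarrow> 'v set set \<Rightarrow> ('v \<Rightarrow> real) set" where
  "realization V E = (\<Union>c\<in>cells V E. simplex_on c)"

definition vertex :: "'v \<Rightarrow> 'v \<Rightarrow> real" where
  "vertex v = (\<lambda>w. if w = v then 1 else 0)"

text \<open>On an edge \<open>{u, v}\<close> the two coordinates sum to \<open>1\<close>, so half the \<open>\<ell>\<^sup>1\<close>-distance is
  \<open>\<bar>p u - q u\<bar>\<close>; thus every edge is isometric to the unit interval.\<close>

definition seg_length :: "('v \<Rightarrow> real) \<Rightarrow> ('v \<Rightarrow> real) \<Rightarrow> real" where
  "seg_length p q = (\<Sum>v | p v \<noteq> q v. \<bar>p v - q v\<bar>) / 2"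

text \<open>A piecewise linear path is given by its list of break points, consecutive ones lying in a
  common closed cell; the path metric is the infimum of the lengths of such paths.\<close>

definition pl_path :: "'v set \<Rightarrow> 'v set set \<Rightarrow> ('v \<Rightarrow> real) list \<Rightarrow> bool" where
  "pl_path V E ps \<longleftrightarrow> ps \<noteq> [] \<and> set ps \<subseteq> realization V E \<and>
     successively (\<lambda>p q. \<exists>c\<in>cells V E. p \<in> simplex_on c \<and> q \<in> simplex_on c) ps"

fun path_length :: "('v \<Rightarrow> real) list \<Rightarrow> real" where
  "path_length (p # q # ps) = seg_length p q + path_length (q # ps)"
| "path_length _ = 0"

text \<open>The value outside the realization is irrelevant; it is set to \<open>0\<close> because the locale
  \<open>Metric_space\<close> asks for nonnegativity and symmetry on the whole type.\<close>

definition path_dist :: "'v set \<Rightarrow> 'v set set \<Rightarrow> ('v \<Rightarrow> real) \<Rightarrow> ('v \<Rightarrow> real) \<Rightarrow> real" where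
  "path_dist V E p q =
     (if p \<in> realization V E \<and> q \<in> realization V E
      then Inf {path_length ps | ps. pl_path V E ps \<and> hd ps = p \<and> last ps = q}
      else 0)"


section \<open>Biinvariant word metrics and Cayley graphs\<close>

definition conj_closure :: "('a, 'b) monoid_scheme \<Rightarrow> 'a set \<Rightarrow> 'a set" where
  "conj_closure G S = {x \<otimes>\<^bsub>G\<^esub> s \<otimes>\<^bsub>G\<^esub> inv\<^bsub>G\<^esub> x | x s. x \<in> carrier G \<and> s \<in> S}"

definition biinv_norm :: "('a, 'b) monoid_scheme \<Rightarrow> 'a set \<Rightarrow> 'a \<Rightarrow> nat" where
  "biinv_norm G S g =
     (LEAST k. \<exists>ss. length ss = k \<and> set ss \<subseteq> conj_closure G S \<and> g = foldr (\<otimes>\<^bsub>G\<^esub>) ss \<one>\<^bsub>G\<^esub>)"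

definition biinv_dist :: "('a, 'b) monoid_scheme \<Rightarrow> 'a set \<Rightarrow> 'a \<Rightarrow> 'a \<Rightarrow> nat" where
  "biinv_dist G S g h = biinv_norm G S (g \<otimes>\<^bsub>G\<^esub> inv\<^bsub>G\<^esub> h)"

definition biinv_cayley_edges :: "('a, 'b) monoid_scheme \<Rightarrow> 'a set \<Rightarrow> 'a set set" where
  "biinv_cayley_edges G S =
     {{g, h} | g h. g \<in> carrier G \<and> h \<in> carrier G \<and> g \<otimes>\<^bsub>G\<^esub> inv\<^bsub>G\<^esub> h \<in> conj_closure G S}"


section \<open>The free group on two generators\<close>

text \<open>Elements of the free group are reduced words; the letter \<open>(x, True)\<close> stands for the
  generator \<open>x\<close> and \<open>(x, False)\<close> for its inverse. The product \<open>u v\<close> is obtained by prefixing the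
  letters of \<open>u\<close> to \<open>v\<close> from right to left, cancelling whenever possible.\<close>

type_synonym 'g letter = "'g \<times> bool"

definition inv_letter :: "'g letter \<Rightarrow> 'g letter" where
  "inv_letter x = (fst x, \<not> snd x)"

definition reduced :: "'g letter list \<Rightarrow> bool" where
  "reduced w \<longleftrightarrow> successively (\<lambda>x y. y \<noteq> inv_letter x) w"

fun prefix_letter :: "'g letter \<Rightarrow> 'g letter list \<Rightarrow> 'g letter list" where
  "prefix_letter x [] = [x]"
| "prefix_letter x (y # w) = (if y = inv_letter x then w else x # y # w)"

definition free_group :: "'g letter list monoid" where
  "free_group = \<lparr>carrier = {w. reduced w}, mult = foldr prefix_letter, one = []\<rparr>"

datatype gen = Gen_a | Gen_b

abbreviation F2 :: "gen letter list monoid" where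
  "F2 \<equiv> free_group"

definition F2_gens :: "gen letter list set" where
  "F2_gens = {[(Gen_a, True)], inv\<^bsub>F2\<^esub> [(Gen_a, True)], [(Gen_b, True)], inv\<^bsub>F2\<^esub> [(Gen_b, True)]}"


section \<open>Basic facts\<close>

subsection \<open>The free group is a group\<close>

lemma inv_letter_invol [simp]: "inv_letter (inv_letter x) = x"
  by (simp add: inv_letter_def)

lemma inv_letter_neq [simp]: "inv_letter x \<noteq> x" "x \<noteq> inv_letter x"
  by (simp_all add: inv_letter_def prod_eq_iff)

lemma reduced_Nil [simp]: "reduced []"
  by (simp add: reduced_def)

lemma reduced_Cons: "reduced (x # w) \<longleftrightarrow> w = [] \<or> hd w \<noteq> inv_letter x \<and> reduced w"
  by (auto simp: reduced_def successively_Cons)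

lemma reduced_prefix: "reduced w \<Longrightarrow> reduced (prefix_letter x w)"
  by (cases w) (auto simp: reduced_Cons)

lemma reduced_foldr: "reduced w \<Longrightarrow> reduced (foldr prefix_letter u w)"
  by (induction u) (auto simp: reduced_prefix)

lemma prefix_cancel: "reduced w \<Longrightarrow> prefix_letter x (prefix_letter (inv_letter x) w) = w"
  by (cases w; cases "tl w") (auto simp: reduced_Cons)

lemma prefix_reduced: "reduced (x # w) \<Longrightarrow> prefix_letter x w = x # w"
  by (cases w) (auto simp: reduced_Cons)

lemma foldr_prefix_Nil: "reduced u \<Longrightarrow> foldr prefix_letter u [] = u"
proof (induction u)
  case (Cons x u)
  then have "reduced u" by (auto simp: reduced_Cons)
  with Cons show ?case by (simp add: prefix_reduced)
qed simp

lemma foldr_prefix_letter: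
  "reduced w \<Longrightarrow> foldr prefix_letter (prefix_letter x u) w = prefix_letter x (foldr prefix_letter u w)"
  by (cases u) (auto simp: prefix_cancel reduced_foldr)

lemma foldr_prefix_assoc:
  "reduced w \<Longrightarrow>
   foldr prefix_letter (foldr prefix_letter u v) w = foldr prefix_letter u (foldr prefix_letter v w)"
  by (induction u) (auto simp: foldr_prefix_letter)

lemma reduced_inverse:
  assumes "reduced u"
  shows "reduced (rev (map inv_letter u))"
proof -
  have "(\<lambda>x y. inv_letter x \<noteq> inv_letter (inv_letter y)) = (\<lambda>x y. y \<noteq> inv_letter (x :: 'a letter))"
    by (intro ext) auto
  then show ?thesis using assms by (simp only: reduced_def successively_rev successively_map)
qed

lemma foldr_prefix_inverse:
  "reduced w \<Longrightarrow> foldr prefix_letter (rev (map inv_letter u)) (foldr prefix_letter u w) = w"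
proof (induction u arbitrary: w)
  case (Cons x u)
  have "prefix_letter (inv_letter x) (prefix_letter x (foldr prefix_letter u w)) = foldr prefix_letter u w"
    using prefix_cancel[of _ "inv_letter x"] Cons.prems by (simp add: reduced_foldr)
  with Cons show ?case by simp
qed simp

lemma group_free_group: "group (free_group :: 'g letter list monoid)"
proof (rule groupI)
  fix u :: "'g letter list"
  assume "u \<in> carrier free_group"
  then have "reduced u" by (simp add: free_group_def)
  then have "foldr prefix_letter (rev (map inv_letter u)) u = []"
    using foldr_prefix_inverse[of "[]" u] by (simp add: foldr_prefix_Nil)
  with \<open>reduced u\<close> show "\<exists>v\<in>carrier free_group. v \<otimes>\<^bsub>free_group\<^esub> u = \<one>\<^bsub>free_group\<^esub>"
    by (intro bexI[of _ "rev (map inv_letter u)"]) (auto simp: free_group_def reduced_inverse)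
qed (auto simp: free_group_def reduced_foldr foldr_prefix_assoc)

lemma inv_free_group_letter:
  "inv\<^bsub>free_group\<^esub> [x] = [inv_letter x]"
proof -
  interpret group "free_group :: 'a letter list monoid" by (rule group_free_group)
  show ?thesis
    by (rule inv_equality) (auto simp: free_group_def reduced_Cons)
qed

lemma F2_gens_eq: "F2_gens = {[(Gen_a, True)], [(Gen_a, False)], [(Gen_b, True)], [(Gen_b, False)]}"
  by (simp add: F2_gens_def inv_free_group_letter inv_letter_def)

subsection \<open>The path metric of a connected graph is a metric\<close>

lemma vertex_in_simplex [simp]: "vertex v \<in> simplex_on {v}"
  by (simp add: vertex_def simplex_on_def)

lemma vertex_in_realization: "v \<in> V \<Longrightarrow> vertex v \<in> realization V E"
  by (simp add: realization_def cells_def bexI[of _ v])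

lemma seg_length_nonneg: "0 \<le> seg_length p q"
  by (simp add: seg_length_def sum_nonneg)

lemma path_length_nonneg: "0 \<le> path_length ps"
  by (induction ps rule: path_length.induct) (auto simp: seg_length_nonneg)

lemma seg_length_commute: "seg_length p q = seg_length q p"
  unfolding seg_length_def
  by (rule arg_cong[where f = "\<lambda>x. x / 2"], rule sum.cong) (auto simp: abs_minus_commute)

lemma path_length_append:
  "path_length (ps @ q # qs) = path_length (ps @ [q]) + path_length (q # qs)"
  by (induction ps rule: path_length.induct) (auto simp: neq_Nil_conv)

lemma path_length_rev: "path_length (rev ps) = path_length ps"
proof (induction ps rule: path_length.induct)
  case (1 p q ps)
  have "path_length (rev ps @ [q, p]) = path_length (rev ps @ [q]) + path_length [q, p]"
    by (rule path_length_append)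
  with 1 show ?case by (simp add: seg_length_commute)
qed auto

lemma seg_length_same [simp]: "seg_length p p = 0"
  by (simp add: seg_length_def)

lemma simplex_seg_length:
  assumes "p \<in> simplex_on c" "q \<in> simplex_on c" "finite c"
  shows "seg_length p q = (\<Sum>v\<in>c. \<bar>p v - q v\<bar>) / 2"
proof -
  have "(\<Sum>v | p v \<noteq> q v. \<bar>p v - q v\<bar>) = (\<Sum>v\<in>c. \<bar>p v - q v\<bar>)"
  proof (rule sum.mono_neutral_left)
    show "{v. p v \<noteq> q v} \<subseteq> c"
    proof clarify
      fix v assume "p v \<noteq> q v"
      then show "v \<in> c" using assms by (cases "v \<in> c") (auto simp: simplex_on_def)
    qed
  qed (use assms in auto)
  then show ?thesis by (simp add: seg_length_def)
qed

lemma seg_length_edge: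
  assumes "p \<in> simplex_on {a, b}" "q \<in> simplex_on {a, b}" "a \<noteq> b"
  shows "seg_length p q = \<bar>p a - q a\<bar>"
proof -
  have "p b = 1 - p a" "q b = 1 - q a"
    using assms by (auto simp: simplex_on_def)
  moreover from this have "\<bar>p b - q b\<bar> = \<bar>p a - q a\<bar>" by simp
  ultimately show ?thesis
    using simplex_seg_length[OF assms(1,2)] assms(3) by simp
qed

lemma simplex_singleton: "p \<in> simplex_on {a} \<longleftrightarrow> p = vertex a"
  by (auto simp: simplex_on_def vertex_def)

lemma cells_cases:
  assumes "simple_graph V E" "c \<in> cells V E"
  obtains v where "v \<in> V" "c = {v}"
  | a b where "{a, b} \<in> E" "a \<in> V" "b \<in> V" "a \<noteq> b" "c = {a, b}"
  using assms unfolding cells_def simple_graph_def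
  by (auto simp: card_2_iff)

lemma lipschitz_path_length:
  assumes "pl_path V E ps"
    and "\<And>c p q. c \<in> cells V E \<Longrightarrow> p \<in> simplex_on c \<Longrightarrow> q \<in> simplex_on c \<Longrightarrow> \<bar>\<phi> p - \<phi> q\<bar> \<le> seg_length p q"
  shows "\<bar>\<phi> (hd ps) - \<phi> (last ps)\<bar> \<le> path_length ps"
  using assms(1)
proof (induction ps rule: path_length.induct)
  case (1 p q ps)
  then have "\<bar>\<phi> p - \<phi> q\<bar> \<le> seg_length p q" "pl_path V E (q # ps)"
    using assms(2) by (auto simp: pl_path_def)
  with 1 show ?case by (auto split: if_splits)
qed (auto simp: pl_path_def)

lemma coord_lipschitz:
  assumes "simple_graph V E" "c \<in> cells V E" "p \<in> simplex_on c" "q \<in> simplex_on c"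
  shows "\<bar>p v - q v\<bar> \<le> seg_length p q"
  using assms(1,2)
proof (cases rule: cells_cases)
  case (1 u)
  with assms show ?thesis by (simp add: simplex_singleton)
next
  case (2 a b)
  have "p b = 1 - p a" "q b = 1 - q a" "v \<notin> {a, b} \<Longrightarrow> p v = q v"
    using assms 2 by (auto simp: simplex_on_def)
  moreover have "seg_length p q = \<bar>p a - q a\<bar>"
    using assms 2 seg_length_edge by metis
  ultimately show ?thesis by (cases "v = a"; cases "v = b") auto
qed

lemma pl_path_append:
  assumes "pl_path V E ps" "pl_path V E qs" "last ps = hd qs"
  shows "pl_path V E (ps @ tl qs)" "hd (ps @ tl qs) = hd ps" "last (ps @ tl qs) = last qs"
    "path_length (ps @ tl qs) = path_length ps + path_length qs"
proof -
  obtain q qs' where qs: "qs = q # qs'" using assms by (cases qs) (auto simp: pl_path_def)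
  obtain ps' where ps: "ps = ps' @ [q]"
    using assms qs by (metis append_butlast_last_id list.sel(1) pl_path_def)
  show "pl_path V E (ps @ tl qs)"
    using assms qs ps by (auto simp: pl_path_def successively_append_iff successively_Cons)
  show "hd (ps @ tl qs) = hd ps" using ps by (cases ps') auto
  show "last (ps @ tl qs) = last qs" using ps qs by simp
  show "path_length (ps @ tl qs) = path_length ps + path_length qs"
    using path_length_append[of ps' q qs'] ps qs by simp
qed

lemma pl_path_rev: "pl_path V E ps \<Longrightarrow> pl_path V E (rev ps)"
  unfolding pl_path_def by (auto simp: conj_commute)

lemma edge_cell:
  assumes "simple_graph V E" "adj E u v"
  shows "vertex u \<in> simplex_on {u, v}" "vertex v \<in> simplex_on {u, v}" "{u, v} \<in> cells V E" "u \<in> V"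
    "v \<in> V" "u \<noteq> v"
proof -
  have "{u, v} \<in> E" "{u, v} \<subseteq> V" "card {u, v} = 2"
    using assms by (auto simp: simple_graph_def adj_def)
  moreover from this show "u \<noteq> v" by (auto simp: card_insert_if)
  ultimately show "vertex u \<in> simplex_on {u, v}" "vertex v \<in> simplex_on {u, v}"
    "{u, v} \<in> cells V E" "u \<in> V" "v \<in> V"
    by (auto simp: simplex_on_def vertex_def cells_def)
qed

lemma pl_path_relpowp:
  assumes "simple_graph V E" "u \<in> V" "(adj E ^^ n) u v"
  shows "\<exists>ps. pl_path V E ps \<and> hd ps = vertex u \<and> last ps = vertex v \<and> path_length ps = real n"
  using assms(3)
proof (induction n arbitrary: v)
  case 0
  then show ?case using assms(2)
    by (intro exI[of _ "[vertex u]"]) (auto simp: pl_path_def vertex_in_realization)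
next
  case (Suc n)
  then obtain w where w: "(adj E ^^ n) u w" "adj E w v" by auto
  then obtain ps where ps: "pl_path V E ps" "hd ps = vertex u" "last ps = vertex w" "path_length ps = real n"
    using Suc.IH by blast
  note e = edge_cell[OF assms(1) w(2)]
  have q: "pl_path V E [vertex w, vertex v]"
    using e by (auto simp: pl_path_def vertex_in_realization)
  have "path_length [vertex w, vertex v] = 1"
    using seg_length_edge[OF e(1,2) e(6)] e(6) by (simp add: vertex_def)
  then show ?case
    using pl_path_append[OF ps(1) q] ps by (intro exI[of _ "ps @ [vertex v]"]) auto
qed

lemma pl_path_to_vertex:
  assumes "simple_graph V E" "p \<in> realization V E"
  shows "\<exists>v\<in>V. pl_path V E [p, vertex v]"
proof -
  obtain c where c: "c \<in> cells V E" "p \<in> simplex_on c"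
    using assms by (auto simp: realization_def)
  from assms(1) c(1) show ?thesis
  proof (cases rule: cells_cases)
    case (1 v)
    with assms c show ?thesis
      by (auto simp: pl_path_def vertex_in_realization intro!: bexI[of _ v] bexI[of _ c])
  next
    case (2 a b)
    then have "vertex a \<in> simplex_on c"
      using edge_cell[OF assms(1), of a b] by (simp add: adj_def)
    with 2 assms c show ?thesis
      by (auto simp: pl_path_def vertex_in_realization intro!: bexI[of _ a] bexI[of _ c])
  qed
qed

lemma pl_path_exists:
  assumes "connected_graph V E" "p \<in> realization V E" "q \<in> realization V E"
  shows "\<exists>ps. pl_path V E ps \<and> hd ps = p \<and> last ps = q"
proof -
  have s: "simple_graph V E" using assms by (simp add: connected_graph_def)
  obtain u v where u: "u \<in> V" "pl_path V E [p, vertex u]" and v: "v \<in> V" "pl_path V E [q, vertex v]"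
    using pl_path_to_vertex[OF s] assms(2,3) by blast
  have "(adj E)\<^sup>*\<^sup>* u v" using assms u v by (simp add: connected_graph_def)
  then obtain n where "(adj E ^^ n) u v" by (metis rtranclp_imp_relpowp)
  then obtain ps where ps: "pl_path V E ps" "hd ps = vertex u" "last ps = vertex v"
    using pl_path_relpowp[OF s u(1)] by blast
  note 1 = pl_path_append[OF u(2) ps(1)]
  have v': "pl_path V E [vertex v, q]" using pl_path_rev[OF v(2)] by simp
  show ?thesis
    using pl_path_append[OF 1(1) v'] 1 ps by auto
qed

lemma bdd_below_path_lengths:
  "bdd_below {path_length ps | ps. pl_path V E ps \<and> hd ps = p \<and> last ps = q}"
  by (rule bdd_belowI[of _ 0]) (auto simp: path_length_nonneg)

lemma path_dist_le:
  assumes "pl_path V E ps"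
  shows "path_dist V E (hd ps) (last ps) \<le> path_length ps"
proof -
  have "hd ps \<in> realization V E" "last ps \<in> realization V E"
    using assms by (auto simp: pl_path_def subset_iff)
  then show ?thesis
    using assms unfolding path_dist_def
    by (auto intro!: cInf_lower[OF _ bdd_below_path_lengths])
qed

lemma path_dist_greatest:
  assumes "connected_graph V E" "p \<in> realization V E" "q \<in> realization V E"
    and "\<And>ps. pl_path V E ps \<Longrightarrow> hd ps = p \<Longrightarrow> last ps = q \<Longrightarrow> r \<le> path_length ps"
  shows "r \<le> path_dist V E p q"
  using pl_path_exists[OF assms(1-3)] assms(2-) unfolding path_dist_def
  by (auto intro!: cInf_greatest)

lemma path_dist_commute: "path_dist V E p q = path_dist V E q p"
proof -
  have "{path_length ps | ps. pl_path V E ps \<and> hd ps = p \<and> last ps = q}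
      \<subseteq> {path_length ps | ps. pl_path V E ps \<and> hd ps = q \<and> last ps = p}" for p q
  proof clarify
    fix ps assume "pl_path V E ps" "p = hd ps" "q = last ps"
    then show "\<exists>qs. path_length ps = path_length qs \<and> pl_path V E qs \<and> hd qs = last ps \<and> last qs = hd ps"
      by (intro exI[of _ "rev ps"])
        (auto simp: path_length_rev pl_path_rev hd_rev last_rev)
  qed
  then have "{path_length ps | ps. pl_path V E ps \<and> hd ps = p \<and> last ps = q}
      = {path_length ps | ps. pl_path V E ps \<and> hd ps = q \<and> last ps = p}"
    by (intro equalityI) auto
  then show ?thesis unfolding path_dist_def by auto
qed

theorem Metric_space_path_dist:
  assumes "connected_graph V E"
  shows "Metric_space (realization V E) (path_dist V E)"
proof
  have s: "simple_graph V E" using assms by (simp add: connected_graph_def)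
  show "0 \<le> path_dist V E p q" for p q
  proof (cases "p \<in> realization V E \<and> q \<in> realization V E")
    case True
    then show ?thesis by (auto intro!: path_dist_greatest assms path_length_nonneg)
  qed (auto simp: path_dist_def)
  show "path_dist V E p q = path_dist V E q p" for p q
    by (rule path_dist_commute)
  show "path_dist V E p q = 0 \<longleftrightarrow> p = q" if "p \<in> realization V E" "q \<in> realization V E" for p q
  proof
    assume "p = q"
    then have "path_dist V E p q \<le> 0"
      using path_dist_le[of V E "[p]"] that by (simp add: pl_path_def)
    moreover have "0 \<le> path_dist V E p q"
      using that by (auto intro!: path_dist_greatest assms path_length_nonneg)
    ultimately show "path_dist V E p q = 0" by simp
  next
    assume 0: "path_dist V E p q = 0"
    show "p = q"
    proof
      fix v
      have "\<bar>p v - q v\<bar> \<le> path_dist V E p q"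
      proof (rule path_dist_greatest[OF assms that])
        fix ps assume "pl_path V E ps" "hd ps = p" "last ps = q"
        then show "\<bar>p v - q v\<bar> \<le> path_length ps"
          using lipschitz_path_length[of V E ps "\<lambda>p. p v"] coord_lipschitz[OF s] by blast
      qed
      then show "p v = q v" using 0 by simp
    qed
  qed
  show "path_dist V E p r \<le> path_dist V E p q + path_dist V E q r"
    if "p \<in> realization V E" "q \<in> realization V E" "r \<in> realization V E" for p q r
  proof -
    have "path_dist V E p r - path_dist V E p q \<le> path_dist V E q r"
    proof (rule path_dist_greatest[OF assms that(2,3)])
      fix qs assume qs: "pl_path V E qs" "hd qs = q" "last qs = r"
      have "path_dist V E p r - path_length qs \<le> path_dist V E p q"
      proof (rule path_dist_greatest[OF assms that(1,2)])
        fix ps assume ps: "pl_path V E ps" "hd ps = p" "last ps = q"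
        show "path_dist V E p r - path_length qs \<le> path_length ps"
          using path_dist_le[OF pl_path_append(1)[OF ps(1) qs(1)]]
            pl_path_append(2-)[OF ps(1) qs(1)] ps qs by simp
      qed
      then show "path_dist V E p r - path_dist V E p q \<le> path_length qs" by simp
    qed
    then show ?thesis by simp
  qed
qed

subsection \<open>The path metric on vertices\<close>

lemma path_dist_vertices:
  assumes "connected_graph V E" "u \<in> V" "v \<in> V"
  shows "path_dist V E (vertex u) (vertex v) = real (LEAST n. (adj E ^^ n) u v)"
proof (rule antisym)
  have s: "simple_graph V E" using assms by (simp add: connected_graph_def)
  define D where "D w = (LEAST n. (adj E ^^ n) u w)" for w
  have D: "(adj E ^^ D w) u w" if "w \<in> V" for w
  proof -
    have "(adj E)\<^sup>*\<^sup>* u w" using assms that by (simp add: connected_graph_def)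
    then obtain n where "(adj E ^^ n) u w" by (metis rtranclp_imp_relpowp)
    then show ?thesis unfolding D_def by (rule LeastI)
  qed
  show "path_dist V E (vertex u) (vertex v) \<le> real (LEAST n. (adj E ^^ n) u v)"
    using pl_path_relpowp[OF s assms(2) D[OF assms(3)]] path_dist_le unfolding D_def by metis
  have D_adj: "D b \<le> Suc (D a)" if "adj E a b" for a b
    using relpowp_Suc_I[OF D that] edge_cell[OF s that] unfolding D_def by (simp add: Least_le)
  have "D u = 0" unfolding D_def by (rule Least_eq_0) simp
  define \<phi> where "\<phi> p = Min ((\<lambda>w. real (D w) + 1 - p w) ` {w. p w \<noteq> 0})" for p
  have \<phi>_vertex: "\<phi> (vertex w) = real (D w)" for w
    by (simp add: \<phi>_def vertex_def)
  have \<phi>_edge: "\<phi> p = min (real (D a) + 1 - p a) (real (D b) + 1 - p b)"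
    if "adj E a b" "p \<in> simplex_on {a, b}" for a b p
  proof -
    have ab: "a \<noteq> b" using edge_cell[OF s that(1)] by simp
    have p: "p b = 1 - p a" "\<And>v. v \<notin> {a, b} \<Longrightarrow> p v = 0"
      using that(2) ab by (auto simp: simplex_on_def)
    have "D b \<le> Suc (D a)" "D a \<le> Suc (D b)"
      using D_adj[of a b] D_adj[of b a] that(1) by (auto simp: adj_def insert_commute)
    then have D': "real (D b) \<le> real (D a) + 1" "real (D a) \<le> real (D b) + 1" by linarith+
    consider "p a = 0" | "p a = 1" | "p a \<noteq> 0" "p b \<noteq> 0" using p by force
    then show ?thesis
    proof cases
      case 1
      then have "{w. p w \<noteq> 0} = {b}" using p by fastforce
      then show ?thesis using 1 p D' by (simp add: \<phi>_def)
    next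
      case 2
      then have "{w. p w \<noteq> 0} = {a}" using p by fastforce
      then show ?thesis using 2 p D' by (simp add: \<phi>_def)
    next
      case 3
      then have "{w. p w \<noteq> 0} = {a, b}" using p by fastforce
      then show ?thesis by (simp add: \<phi>_def)
    qed
  qed
  have lip: "\<bar>\<phi> p - \<phi> q\<bar> \<le> seg_length p q"
    if "c \<in> cells V E" "p \<in> simplex_on c" "q \<in> simplex_on c" for c p q
    using s that(1)
  proof (cases rule: cells_cases)
    case (1 w)
    with that show ?thesis by (simp add: simplex_singleton)
  next
    case (2 a b)
    then have "p b = 1 - p a" "q b = 1 - q a" using that by (auto simp: simplex_on_def)
    moreover have "adj E a b" using 2 by (simp add: adj_def)
    ultimately show ?thesis
      using \<phi>_edge[of a b p] \<phi>_edge[of a b q] that 2 seg_length_edge[of p a b q]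
      by (auto simp: min_def abs_if)
  qed
  have "real (D v) \<le> path_dist V E (vertex u) (vertex v)"
  proof (rule path_dist_greatest[OF assms(1)])
    fix ps assume "pl_path V E ps" "hd ps = vertex u" "last ps = vertex v"
    then show "real (D v) \<le> path_length ps"
      using lipschitz_path_length[of V E ps \<phi>, OF _ lip] \<open>D u = 0\<close> by (simp add: \<phi>_vertex)
  qed (simp_all add: vertex_in_realization assms)
  then show "real (LEAST n. (adj E ^^ n) u v) \<le> path_dist V E (vertex u) (vertex v)"
    by (simp add: D_def)
qed

subsection \<open>The biinvariant Cayley graph of the free group\<close>

lemma (in group) conj_closure_closed:
  assumes "S \<subseteq> carrier G" "s \<in> conj_closure G S"
  shows "s \<in> carrier G"
  using assms by (auto simp: conj_closure_def)

lemma (in group) conj_closure_inv: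
  assumes "S \<subseteq> carrier G" "\<And>s. s \<in> S \<Longrightarrow> inv s \<in> S" "s \<in> conj_closure G S"
  shows "inv s \<in> conj_closure G S"
proof -
  obtain x t where xt: "x \<in> carrier G" "t \<in> S" "s = x \<otimes> t \<otimes> inv x"
    using assms(3) by (auto simp: conj_closure_def)
  then have "inv s = x \<otimes> inv t \<otimes> inv x"
    using assms(1) by (auto simp: inv_mult_group m_assoc)
  then show ?thesis using xt assms(2) by (auto simp: conj_closure_def)
qed

lemma (in group) one_notin_conj_closure:
  assumes "S \<subseteq> carrier G" "\<one> \<notin> S"
  shows "\<one> \<notin> conj_closure G S"
proof
  assume "\<one> \<in> conj_closure G S"
  then obtain x t where xt: "x \<in> carrier G" "t \<in> S" "\<one> = x \<otimes> t \<otimes> inv x"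
    by (auto simp: conj_closure_def)
  then have t: "t \<in> carrier G" using assms by auto
  have "x \<otimes> t = x" using xt t by (metis inv_inv inv_closed m_closed inv_equality)
  then have "t = \<one>" using xt t by (metis l_cancel_one')
  then show False using xt assms by simp
qed

lemma (in group) adj_cayley_iff:
  assumes "S \<subseteq> carrier G" "\<And>s. s \<in> S \<Longrightarrow> inv s \<in> S"
  shows "adj (biinv_cayley_edges G S) g h \<longleftrightarrow>
    g \<in> carrier G \<and> h \<in> carrier G \<and> g \<otimes> inv h \<in> conj_closure G S"
proof
  assume "adj (biinv_cayley_edges G S) g h"
  then obtain x y where xy: "{g, h} = {x, y}" "x \<in> carrier G" "y \<in> carrier G"
      "x \<otimes> inv y \<in> conj_closure G S"
    by (auto simp: adj_def biinv_cayley_edges_def)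
  moreover have "inv (x \<otimes> inv y) = y \<otimes> inv x"
    using xy by (simp add: inv_mult_group)
  ultimately have "y \<otimes> inv x \<in> conj_closure G S"
    using conj_closure_inv[OF assms] by metis
  then show "g \<in> carrier G \<and> h \<in> carrier G \<and> g \<otimes> inv h \<in> conj_closure G S"
    using xy by (auto simp: doubleton_eq_iff)
qed (auto simp: adj_def biinv_cayley_edges_def)

lemma (in group) relpowp_cayley_iff:
  assumes "S \<subseteq> carrier G" "\<And>s. s \<in> S \<Longrightarrow> inv s \<in> S" "g \<in> carrier G" "h \<in> carrier G"
  shows "(adj (biinv_cayley_edges G S) ^^ n) g h \<longleftrightarrow>
    (\<exists>ss. length ss = n \<and> set ss \<subseteq> conj_closure G S \<and> g \<otimes> inv h = foldr (\<otimes>) ss \<one>)"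
  using assms(3)
proof (induction n arbitrary: g)
  case 0
  have "g \<otimes> inv h = \<one> \<longleftrightarrow> g = h"
    using 0 assms(4) by (metis inv_closed inv_equality inv_inv r_inv)
  then show ?case by simp
next
  case (Suc n)
  note adj = adj_cayley_iff[OF assms(1,2)] and cl = conj_closure_closed[OF assms(1)]
  show ?case
  proof
    assume "(adj (biinv_cayley_edges G S) ^^ Suc n) g h"
    then obtain y where y: "adj (biinv_cayley_edges G S) g y" "(adj (biinv_cayley_edges G S) ^^ n) y h"
      by (metis relpowp_Suc_D2)
    then obtain ss where ss: "length ss = n" "set ss \<subseteq> conj_closure G S" "y \<otimes> inv h = foldr (\<otimes>) ss \<one>"
      using Suc.IH[of y] adj by auto
    have "(g \<otimes> inv y) \<otimes> (y \<otimes> inv h) = g \<otimes> inv h"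
      using Suc.prems y(1) adj assms(4) by (simp add: m_assoc inv_solve_left')
    then show "\<exists>ss. length ss = Suc n \<and> set ss \<subseteq> conj_closure G S \<and> g \<otimes> inv h = foldr (\<otimes>) ss \<one>"
      using ss y(1) adj by (intro exI[of _ "(g \<otimes> inv y) # ss"]) auto
  next
    assume "\<exists>ss. length ss = Suc n \<and> set ss \<subseteq> conj_closure G S \<and> g \<otimes> inv h = foldr (\<otimes>) ss \<one>"
    then obtain s ss where ss: "length ss = n" "s \<in> conj_closure G S" "set ss \<subseteq> conj_closure G S"
        "g \<otimes> inv h = s \<otimes> foldr (\<otimes>) ss \<one>"
      by (auto simp: length_Suc_conv)
    have s: "s \<in> carrier G" using ss cl by blast
    have p: "foldr (\<otimes>) ss \<one> \<in> carrier G" using ss(3) by (induction ss) (auto intro: cl)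
    define y where "y = inv s \<otimes> g"
    have y: "y \<in> carrier G" using s Suc.prems by (simp add: y_def)
    have "g \<otimes> inv y = s"
      using s Suc.prems by (simp add: y_def inv_mult_group m_assoc[symmetric])
    then have "adj (biinv_cayley_edges G S) g y" using adj y ss Suc.prems by simp
    moreover have "y \<otimes> inv h = foldr (\<otimes>) ss \<one>"
      using ss(4) s p Suc.prems assms(4) by (simp add: y_def m_assoc inv_solve_left')
    then have "(adj (biinv_cayley_edges G S) ^^ n) y h"
      using Suc.IH[OF y] ss by blast
    ultimately show "(adj (biinv_cayley_edges G S) ^^ Suc n) g h" by (rule relpowp_Suc_I2)
  qed
qed

interpretation F2: group F2 by (rule group_free_group)

lemma F2_gens_closed: "F2_gens \<subseteq> carrier F2"
  by (auto simp: F2_gens_eq free_group_def reduced_Cons)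

lemma F2_gens_inv: "s \<in> F2_gens \<Longrightarrow> inv\<^bsub>F2\<^esub> s \<in> F2_gens"
  by (auto simp: F2_gens_eq inv_free_group_letter inv_letter_def)

lemma F2_one_notin_conj_gens: "\<one>\<^bsub>F2\<^esub> \<notin> conj_closure F2 F2_gens"
  by (rule F2.one_notin_conj_closure[OF F2_gens_closed]) (simp add: F2_gens_eq free_group_def)

lemma F2_letter_in_gens: "[x] \<in> F2_gens"
  by (cases x; cases "fst x"; cases "snd x") (auto simp: F2_gens_eq)

lemma F2_generated:
  "reduced w \<Longrightarrow> w = foldr (\<otimes>\<^bsub>F2\<^esub>) (map (\<lambda>x. [x]) w) \<one>\<^bsub>F2\<^esub>"
proof (induction w)
  case (Cons x w)
  then show ?case using prefix_reduced[OF Cons.prems] by (auto simp: reduced_Cons free_group_def)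
qed (simp add: free_group_def)

theorem connected_F2_cayley: "connected_graph (carrier F2) (biinv_cayley_edges F2 F2_gens)"
  unfolding connected_graph_def simple_graph_def
proof (intro conjI ballI)
  show "carrier F2 \<noteq> {}" by auto
next
  fix e assume "e \<in> biinv_cayley_edges F2 F2_gens"
  then obtain g h where gh: "e = {g, h}" "g \<in> carrier F2" "h \<in> carrier F2"
      "g \<otimes>\<^bsub>F2\<^esub> inv\<^bsub>F2\<^esub> h \<in> conj_closure F2 F2_gens"
    by (auto simp: biinv_cayley_edges_def)
  then have "g \<noteq> h" using F2_one_notin_conj_gens by auto
  with gh show "e \<subseteq> carrier F2" "card e = 2" by auto
next
  fix g h assume gh: "g \<in> carrier F2" "h \<in> carrier F2"
  define w where "w = g \<otimes>\<^bsub>F2\<^esub> inv\<^bsub>F2\<^esub> h"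
  have "w \<in> carrier F2" using gh by (simp add: w_def)
  then have "w = foldr (\<otimes>\<^bsub>F2\<^esub>) (map (\<lambda>x. [x]) w) \<one>\<^bsub>F2\<^esub>"
    by (intro F2_generated) (simp add: free_group_def)
  moreover have "[x] \<in> conj_closure F2 F2_gens" for x
  proof -
    have "[x] \<in> carrier F2" using F2_letter_in_gens F2_gens_closed by blast
    then have "[x] = \<one>\<^bsub>F2\<^esub> \<otimes>\<^bsub>F2\<^esub> [x] \<otimes>\<^bsub>F2\<^esub> inv\<^bsub>F2\<^esub> \<one>\<^bsub>F2\<^esub>" by simp
    then show ?thesis using F2_letter_in_gens F2.one_closed unfolding conj_closure_def by blast
  qed
  ultimately have "\<exists>ss. length ss = length w \<and> set ss \<subseteq> conj_closure F2 F2_gens \<and>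
      g \<otimes>\<^bsub>F2\<^esub> inv\<^bsub>F2\<^esub> h = foldr (\<otimes>\<^bsub>F2\<^esub>) ss \<one>\<^bsub>F2\<^esub>"
    by (intro exI[of _ "map (\<lambda>x. [x]) w"]) (auto simp: w_def)
  then have "(adj (biinv_cayley_edges F2 F2_gens) ^^ length w) g h"
    using F2.relpowp_cayley_iff[OF F2_gens_closed F2_gens_inv gh] by blast
  then show "(adj (biinv_cayley_edges F2 F2_gens))\<^sup>*\<^sup>* g h" by (rule relpowp_imp_rtranclp)
qed

theorem path_dist_F2_cayley:
  assumes "g \<in> carrier F2" "h \<in> carrier F2"
  shows "path_dist (carrier F2) (biinv_cayley_edges F2 F2_gens) (vertex g) (vertex h) =
    real (biinv_dist F2 F2_gens g h)"
  using path_dist_vertices[OF connected_F2_cayley assms]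
    F2.relpowp_cayley_iff[OF F2_gens_closed F2_gens_inv assms]
  by (simp add: biinv_dist_def biinv_norm_def)

end

theory Submission
  imports Defs
begin

text \<open>
A locally compact tree is locally finite (\<open>locally_compact_imp_locally_finite\<close>), hence countable, and
every countable tree embeds isometrically. Label the edges \<open>e\<close> of the tree by the conjugates
\<open>b\<^sup>N a b\<^sup>-\<^sup>N\<close> with \<open>N = 3\<^sup>n\<close>, where \<open>n \<ge> 1\<close> depends injectively on \<open>e\<close>, and the reversed edges by the
inverses. Since the holonomy of this labelling around closed walks in a tree is trivial, the labelling
has a potential: a map \<open>F\<close> from the vertices to the free group such that \<open>F(u) F(v)\<^sup>-\<^sup>1\<close> is the label of
the edge from \<open>u\<close> to \<open>v\<close> (\<open>acyclic_graph_potential\<close>). It sends edges to edges of the Cayley graph, and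
for a path \<open>w\<^sub>0, \<dots>, w\<^sub>k\<close> without repeated vertices \<open>F(w\<^sub>0) F(w\<^sub>k)\<^sup>-\<^sup>1\<close> is a product of \<open>k\<close> conjugates
\<open>b\<^sup>N a\<^sup>\<plusminus>\<^sup>1 b\<^sup>-\<^sup>N\<close> with distinct exponents \<open>N\<close>. The heart of the matter is that such a product has norm at
least \<open>k\<close>.

For this, the norm of an element is at least the number of letters that have to be deleted from any
word spelling it in order to make the word trivial (\<open>cancels_product_of_conjugates\<close>). If only letters
\<open>a\<^sup>\<plusminus>\<^sup>1\<close> are deleted, all \<open>k\<close> of them have to go because the exponents are distinct. If two of them
survive and cancel each other, then deletions of letters \<open>b\<^sup>\<plusminus>\<^sup>1\<close> between them have to make up for the
difference of their exponents. Several pairs may share these deletions, but distinct powers of \<open>3\<close> are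
so independent that each pair requires at least two deletions of its own. Thus keeping a pair saves
nothing (\<open>cancels_signed_sum\<close>).

Finally \<open>F\<close> is extended affinely over the edges. The extension does not increase distances. It does not
decrease them either: the distance from a vertex \<open>F(a)\<close>, interpolated over the edges of the Cayley
graph, is 1-Lipschitz, and for a suitable end point \<open>a\<close> of the edge of \<open>p\<close> its values at the images of
\<open>p\<close> and \<open>q\<close> differ by at least the distance of \<open>p\<close> and \<open>q\<close> (\<open>path_dist_push\<close>).
\<close>

section \<open>Words that become trivial after few deletions\<close>

text \<open>The words that become trivial in the free group after deleting at most \<open>k\<close> letters. The letters that
survive cancel in nested pairs, and the rule \<open>Pair\<close> reads off the pair that contains the first
letter; this grammar makes the nesting available to inductions.\<close>

inductive cancels :: "nat \<Rightarrow> 'g letter list \<Rightarrow> bool" where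
  Nil: "cancels k []"
| Delete: "cancels k u \<Longrightarrow> cancels (Suc k) (x # u)"
| Pair: "cancels k u \<Longrightarrow> cancels l v \<Longrightarrow> cancels (k + l) (x # u @ inv_letter x # v)"

lemma cancels_mono:
  assumes "cancels k w" "k \<le> k'"
  shows "cancels k' w"
  using assms
proof (induction arbitrary: k')
  case (Delete k u x)
  then show ?case by (metis Suc_le_D Suc_le_mono cancels.Delete)
next
  case (Pair k u l v x)
  then have "cancels (k' - k) v" by simp
  with Pair have "cancels (k + (k' - k)) (x # u @ inv_letter x # v)"
    by (intro cancels.Pair) auto
  then show ?case using Pair.prems by simp
qed (rule cancels.Nil)

lemma cancels_append:
  assumes "cancels k u" "cancels l v"
  shows "cancels (k + l) (u @ v)"
  using assms
proof induction
  case (Nil k)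
  then show ?case using cancels_mono by fastforce
next
  case (Pair k u m v' x)
  then show ?case using cancels.Pair[of k u "m + l" "v' @ v" x] by (simp add: add.assoc)
qed (use cancels.Delete in auto)

lemma cancels_ConsE:
  assumes "cancels k (x # w)"
  obtains j where "k = Suc j" "cancels j w"
  | i j u v where "k = i + j" "w = u @ inv_letter x # v" "cancels i u" "cancels j v"
  using assms by (cases rule: cancels.cases) auto

text \<open>Triviality is a property of cyclic words. If the first letter survives, moving it to the end turns
its pair around: \<open>x u x\<^sup>-\<^sup>1 v\<close> becomes \<open>u x\<^sup>-\<^sup>1 v x\<close>, where \<open>x\<^sup>-\<^sup>1\<close> and \<open>x\<close> enclose \<open>v\<close>.\<close>

lemma cancels_rotate1:
  assumes "cancels k (x # w)"
  shows "cancels k (w @ [x])"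
  using assms
proof (cases rule: cancels_ConsE)
  case (1 j)
  then show ?thesis
    using cancels_append[OF 1(2) cancels.Delete[OF cancels.Nil[of 0], of x]] by simp
next
  case (2 i j u v)
  have "cancels (j + 0) (inv_letter x # v @ inv_letter (inv_letter x) # [])"
    by (intro cancels.Pair cancels.Nil 2)
  then show ?thesis using 2 cancels_append by fastforce
qed

lemma cancels_rotate: "cancels k (u @ v) \<longleftrightarrow> cancels k (v @ u)"
proof -
  have "cancels k (v @ u)" if "cancels k (u @ v)" for u v :: "'a letter list"
    using that
  proof (induction u arbitrary: v)
    case (Cons x u)
    then have "cancels k (u @ (v @ [x]))" using cancels_rotate1 by fastforce
    from Cons.IH[OF this] show ?case by simp
  qed simp
  then show ?thesis by blast
qed

text \<open>Deleting only one letter of an adjacent pair \<open>x x\<^sup>-\<^sup>1\<close> leaves the other one paired with some letter of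
\<open>w\<close>; deleting that letter instead costs the same. If both letters survive with other partners, these
partners are mutually inverse, and they can be paired with each other without crossing.\<close>

lemma cancels_Cons_inverse_pair:
  assumes "cancels k (x # inv_letter x # w)"
  shows "cancels k w"
  using assms
proof (cases rule: cancels_ConsE)
  case (1 j)
  from 1(2) show ?thesis
  proof (cases rule: cancels_ConsE)
    case (1 i)
    then show ?thesis using \<open>k = Suc j\<close> cancels_mono by (metis le_SucI lessI less_imp_le)
  next
    case (2 i l u v)
    then show ?thesis
      using cancels_append[OF 2(3) cancels.Delete[OF 2(4)]] \<open>k = Suc j\<close> by simp
  qed
next
  case (2 i j u v)
  show ?thesis
  proof (cases u)
    case Nil
    then show ?thesis using 2 cancels_mono by fastforce
  next
    case (Cons y u')
    then have y: "y = inv_letter x" "w = u' @ inv_letter x # v" using 2 by auto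
    with 2 Cons have "cancels i (inv_letter x # u')" by simp
    then show ?thesis
    proof (cases rule: cancels_ConsE)
      case (1 l)
      then show ?thesis
        using cancels_append[OF 1(2) cancels.Delete[OF \<open>cancels j v\<close>]] 2 y by simp
    next
      case l: (2 l m p q)
      have "cancels (m + j) (x # q @ inv_letter x # v)"
        by (intro cancels.Pair l 2)
      from cancels_append[OF l(3) this] show ?thesis using l 2 y by (simp add: add.assoc)
    qed
  qed
qed

text \<open>By rotation it suffices to treat an inverse pair at the beginning of the word.\<close>

lemma cancels_free_reduction:
  "cancels k (u @ x # inv_letter x # v) \<longleftrightarrow> cancels k (u @ v)"
proof
  assume "cancels k (u @ x # inv_letter x # v)"
  then have "cancels k (x # inv_letter x # v @ u)"
    using cancels_rotate[of k u "x # inv_letter x # v"] by simp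
  then show "cancels k (u @ v)" using cancels_Cons_inverse_pair cancels_rotate by blast
next
  assume "cancels k (u @ v)"
  then have "cancels (0 + k) (x # [] @ inv_letter x # v @ u)"
    by (intro cancels.Pair cancels.Nil) (simp add: cancels_rotate)
  then show "cancels k (u @ x # inv_letter x # v)"
    using cancels_rotate[of k u "x # inv_letter x # v"] by simp
qed

abbreviation word_value :: "'g letter list \<Rightarrow> 'g letter list" where
  "word_value w \<equiv> foldr prefix_letter w []"

lemma cancels_word_value: "cancels k (u @ word_value w) \<longleftrightarrow> cancels k (u @ w)"
proof (induction w arbitrary: u)
  case (Cons x w)
  have "cancels k (u @ prefix_letter x r) \<longleftrightarrow> cancels k (u @ x # r)" for r
    using cancels_free_reduction[of k u x] by (cases r) simp_all
  with Cons[of "u @ [x]"] show ?case by simp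
qed simp

lemma word_value_reduced: "word_value w \<in> carrier free_group"
  by (simp add: free_group_def reduced_foldr)

lemma word_value_append:
  "word_value (u @ v) = word_value u \<otimes>\<^bsub>free_group\<^esub> word_value v"
  using foldr_prefix_assoc[of "word_value v" u "[]"] by (simp add: free_group_def reduced_foldr)

abbreviation inverse_word :: "'g letter list \<Rightarrow> 'g letter list" where
  "inverse_word w \<equiv> rev (map inv_letter w)"

lemma word_value_inverse:
  "word_value (inverse_word w) = inv\<^bsub>free_group\<^esub> (word_value w)"
proof -
  interpret group "free_group :: 'a letter list monoid" by (rule group_free_group)
  have "word_value (inverse_word w) \<otimes>\<^bsub>free_group\<^esub> word_value w = \<one>\<^bsub>free_group\<^esub>"
    unfolding word_value_append[symmetric] using foldr_prefix_inverse[of "[]" w]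
    by (simp add: free_group_def)
  then show ?thesis using inv_equality word_value_reduced by metis
qed

lemma word_value_eq: "w \<in> carrier free_group \<Longrightarrow> word_value w = w"
  by (simp add: free_group_def foldr_prefix_Nil)

lemma cancels_conjugate: "cancels 1 (y @ [x] @ inverse_word y)"
proof (induction y)
  case Nil
  show ?case using cancels.Delete[OF cancels.Nil[of 0]] by simp
next
  case (Cons z y)
  from cancels.Pair[OF Cons cancels.Nil[of 0], of z] show ?case by simp
qed

text \<open>A product of \<open>k\<close> conjugates of letters is spelled by a word in which the \<open>k\<close> conjugated letters can be
deleted. Free reductions lead from this word to every other word with the same value, so the
biinvariant norm is bounded below by the number of deletions that any spelling of an element needs.\<close>

lemma cancels_product_of_conjugates:
  assumes "set ss \<subseteq> conj_closure free_group (range (\<lambda>x. [x]))"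
    and "word_value w = foldr (\<otimes>\<^bsub>free_group\<^esub>) ss \<one>\<^bsub>free_group\<^esub>"
  shows "cancels (length ss) w"
proof -
  have "\<exists>W. cancels (length ss) W \<and> word_value W = foldr (\<otimes>\<^bsub>free_group\<^esub>) ss \<one>\<^bsub>free_group\<^esub>"
    using assms(1)
  proof (induction ss)
    case Nil
    show ?case by (rule exI[of _ "[]"]) (simp add: cancels.Nil free_group_def)
  next
    case (Cons s ss)
    then obtain W where W: "cancels (length ss) W"
        "word_value W = foldr (\<otimes>\<^bsub>free_group\<^esub>) ss \<one>\<^bsub>free_group\<^esub>" by auto
    from Cons.prems obtain y x where s: "y \<in> carrier free_group"
        "s = y \<otimes>\<^bsub>free_group\<^esub> [x] \<otimes>\<^bsub>free_group\<^esub> inv\<^bsub>free_group\<^esub> y"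
      by (auto simp: conj_closure_def)
    interpret group "free_group :: 'a letter list monoid" by (rule group_free_group)
    have "[x] \<in> carrier free_group" by (simp add: free_group_def reduced_Cons)
    then have "word_value (y @ [x] @ inverse_word y) = s"
      using s by (simp only: word_value_append word_value_inverse word_value_eq m_assoc inv_closed)
    then have "word_value ((y @ [x] @ inverse_word y) @ W) = foldr (\<otimes>\<^bsub>free_group\<^esub>) (s # ss) \<one>\<^bsub>free_group\<^esub>"
      using W(2) by (simp only: word_value_append[of _ W]) simp
    moreover have "cancels (length (s # ss)) ((y @ [x] @ inverse_word y) @ W)"
      using cancels_append[OF cancels_conjugate W(1)] by simp
    ultimately show ?case by blast
  qed
  then show ?thesis using assms(2) cancels_word_value[of _ "[]"] by (metis append_Nil)
qed

section \<open>A lower bound for the biinvariant norm\<close>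

text \<open>In a sparse set, distinct elements satisfy no relation with coefficients \<open>\<plusminus>1\<close>, not even up to an
error of \<open>1\<close>. The bound \<open>2\<close> is the price of the two letters in a cancelling pair.\<close>

definition sparse :: "int set \<Rightarrow> bool" where
  "sparse X \<longleftrightarrow> (\<forall>P M. finite P \<longrightarrow> finite M \<longrightarrow> P \<union> M \<subseteq> X \<longrightarrow> P \<inter> M = {} \<longrightarrow> P \<union> M \<noteq> {} \<longrightarrow>
     2 \<le> \<bar>\<Sum>P - \<Sum>M\<bar>)"

lemma sparseD:
  assumes "sparse X" "finite P" "finite M" "P \<union> M \<subseteq> X" "P \<inter> M = {}" "P \<union> M \<noteq> {}"
  shows "2 \<le> \<bar>\<Sum>P - \<Sum>M\<bar>"
  using assms unfolding sparse_def by blast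

text \<open>Modulo three times the smallest power that occurs, a signed sum of distinct powers is plus or minus
that smallest power.\<close>

lemma sparse_powers_of_3: "sparse (range (\<lambda>n. 3 ^ Suc n))"
  unfolding sparse_def
proof (intro allI impI)
  fix P M :: "int set"
  assume fin: "finite P" "finite M" and sub: "P \<union> M \<subseteq> range (\<lambda>n. 3 ^ Suc n)"
    and disj: "P \<inter> M = {}" and ne: "P \<union> M \<noteq> {}"
  define h where "h = Min (P \<union> M)"
  have h: "h \<in> P \<union> M" and h_le: "\<And>x. x \<in> P \<union> M \<Longrightarrow> h \<le> x"
    using fin ne Min_in[of "P \<union> M"] by (auto simp: h_def)
  obtain n where n: "h = 3 ^ Suc n" using h sub by blast
  have dvd: "3 * h dvd x" if x: "x \<in> P \<union> M - {h}" for x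
  proof -
    obtain m where m: "x = 3 ^ Suc m" using x sub by blast
    moreover have "h < x" using h_le[of x] x by (auto simp: less_le)
    ultimately have "n < m" using n by (simp add: power_strict_increasing_iff)
    then show ?thesis unfolding m n power_Suc[symmetric] by (intro le_imp_power_dvd) simp
  qed
  have "3 * h dvd \<Sum>(P - {h})" "3 * h dvd \<Sum>(M - {h})"
    using dvd by (auto intro!: dvd_sum)
  then obtain s t where st: "\<Sum>(P - {h}) = 3 * h * s" "\<Sum>(M - {h}) = 3 * h * t"
    by (auto elim!: dvdE)
  have "\<exists>e. \<bar>e\<bar> = 1 \<and> \<Sum>P - \<Sum>M = h * (e + 3 * (s - t))"
  proof (cases "h \<in> P")
    case True
    then have "h \<notin> M" using disj by auto
    then have "\<Sum>M = 3 * h * t" "\<Sum>P = h + 3 * h * s"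
      using st True sum.remove[OF fin(1) True, of "\<lambda>x. x"] by auto
    then show ?thesis by (intro exI[of _ 1]) (simp add: algebra_simps)
  next
    case False
    then have "h \<in> M" using h by auto
    then have "\<Sum>P = 3 * h * s" "\<Sum>M = h + 3 * h * t"
      using st False sum.remove[OF fin(2) \<open>h \<in> M\<close>, of "\<lambda>x. x"] by auto
    then show ?thesis by (intro exI[of _ "-1"]) (simp add: algebra_simps)
  qed
  then obtain e where e: "\<bar>e\<bar> = 1" "\<Sum>P - \<Sum>M = h * (e + 3 * (s - t))" by blast
  have "1 \<le> \<bar>e + 3 * (s - t)\<bar>" using e(1) by presburger
  moreover have "3 \<le> h" using n by simp
  ultimately have "3 * 1 \<le> \<bar>h\<bar> * \<bar>e + 3 * (s - t)\<bar>" by (intro mult_mono) auto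
  then show "2 \<le> \<bar>\<Sum>P - \<Sum>M\<bar>" using e(2) by (simp add: abs_mult)
qed

text \<open>The exponent sum of the generator \<open>b\<close>.\<close>

fun shift :: "gen letter list \<Rightarrow> int" where
  "shift [] = 0"
| "shift ((Gen_a, e) # w) = shift w"
| "shift ((Gen_b, e) # w) = (if e then 1 else -1) + shift w"

text \<open>Pushing all letters \<open>b\<^sup>\<plusminus>\<^sup>1\<close> of a word to its end turns it into a product of the conjugates
\<open>b\<^sup>n a\<^sup>\<plusminus>\<^sup>1 b\<^sup>-\<^sup>n\<close>, followed by a power of \<open>b\<close>. For \<open>h = 0\<close> the heights are the exponents \<open>n\<close>.\<close>

fun heights :: "int \<Rightarrow> gen letter list \<Rightarrow> int list" where
  "heights h [] = []"
| "heights h ((Gen_a, e) # w) = h # heights h w"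
| "heights h ((Gen_b, e) # w) = heights (h + (if e then 1 else -1)) w"

lemma shift_append: "shift (u @ v) = shift u + shift v"
  by (induction u rule: shift.induct) auto

lemma heights_append: "heights h (u @ v) = heights h u @ heights (h + shift u) v"
  by (induction h u rule: heights.induct) (auto simp: algebra_simps)

text \<open>If no letter \<open>b\<^sup>\<plusminus>\<^sup>1\<close> were deleted, two letters \<open>a\<close> and \<open>a\<^sup>-\<^sup>1\<close> could cancel only at the same height. Hence
a cancelling pair at the heights \<open>h \<noteq> h'\<close> forces deletions of \<open>b\<^sup>\<plusminus>\<^sup>1\<close> in the enclosed word \<open>u\<close> that
change its exponent sum by \<open>h' - h\<close>. Pairs inside \<open>u\<close> account for part of this change, namely for
a signed sum of their heights, and by sparseness the remaining part is at least \<open>2\<close>. So cancelling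
two letters \<open>a\<^sup>\<plusminus>\<^sup>1\<close> is at least as expensive as deleting them. The bound carries the outermost pairs
along: \<open>P\<close> and \<open>M\<close> collect the heights of their right and left ends, and the absolute value bounds
the number of deletions of \<open>b\<^sup>\<plusminus>\<^sup>1\<close> that take place outside of these pairs.\<close>

lemma cancels_signed_sum:
  assumes "cancels k w" "sparse X" "distinct (heights h w)" "set (heights h w) \<subseteq> X"
  shows "\<exists>P M. P \<union> M \<subseteq> set (heights h w) \<and> P \<inter> M = {} \<and>
    int (length (heights h w)) + \<bar>shift w - (\<Sum>P - \<Sum>M)\<bar> \<le> int k"
  using assms
proof (induction arbitrary: h)
  case (Nil k)
  then show ?case by (intro exI[of _ "{}"]) simp
next
  case (Delete k u x)
  define h\<^sub>u where "h\<^sub>u = h + shift [x]"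
  have eq: "heights h (x # u) = heights h [x] @ heights h\<^sub>u u" "shift (x # u) = shift [x] + shift u"
    using heights_append[of h "[x]" u] shift_append[of "[x]" u] by (simp_all add: h\<^sub>u_def)
  obtain P M where PM: "P \<union> M \<subseteq> set (heights h\<^sub>u u)" "P \<inter> M = {}"
      "int (length (heights h\<^sub>u u)) + \<bar>shift u - (\<Sum>P - \<Sum>M)\<bar> \<le> int k"
    using Delete.IH[of h\<^sub>u] Delete.prems unfolding eq by auto
  have "int (length (heights h [x])) + \<bar>shift [x]\<bar> = 1" by (cases x; cases "fst x") auto
  with PM show ?case unfolding eq by (intro exI[of _ P] exI[of _ M]) auto
next
  case (Pair k u l v x)
  define g where "g = fst x"
  define h\<^sub>u where "h\<^sub>u = h + shift [x]"
  define h\<^sub>v where "h\<^sub>v = h + shift u"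
  define H where "H = (if g = Gen_a then {h, h\<^sub>v} else {})"
  have inv: "shift [inv_letter x] = - shift [x]"
    by (cases x; cases "fst x") (auto simp: inv_letter_def)
  have x: "heights i [x] = (if g = Gen_a then [i] else [])"
    "heights i [inv_letter x] = (if g = Gen_a then [i] else [])" "g = Gen_a \<Longrightarrow> shift [x] = 0" for i
    by (cases x; cases "fst x"; simp add: inv_letter_def g_def)+
  have "heights h (x # u @ inv_letter x # v) =
      heights h [x] @ heights h\<^sub>u u @ heights (h\<^sub>u + shift u) [inv_letter x] @
      heights (h\<^sub>u + shift u + shift [inv_letter x]) v"
    using heights_append[of h "[x]" "u @ [inv_letter x] @ v"]
      heights_append[of "h\<^sub>u + shift u" "[inv_letter x]" v]
    by (simp only: heights_append h\<^sub>u_def append_Cons append_Nil)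
  moreover have "heights (h\<^sub>u + shift u) [inv_letter x] = heights h\<^sub>v [inv_letter x]"
    "h\<^sub>u + shift u + shift [inv_letter x] = h\<^sub>v"
    using x inv by (auto simp: h\<^sub>u_def h\<^sub>v_def)
  ultimately have eq: "heights h (x # u @ inv_letter x # v) =
      heights h [x] @ heights h\<^sub>u u @ heights h\<^sub>v [inv_letter x] @ heights h\<^sub>v v"
    by simp
  have sh: "shift (x # u @ inv_letter x # v) = shift u + shift v"
    using shift_append[of "[x]" "u @ inv_letter x # v"] shift_append[of "[inv_letter x]" v] inv
    by (simp add: shift_append)
  have set: "set (heights h (x # u @ inv_letter x # v)) = set (heights h\<^sub>u u) \<union> set (heights h\<^sub>v v) \<union> H"
    and len: "length (heights h (x # u @ inv_letter x # v)) =
      length (heights h\<^sub>u u) + length (heights h\<^sub>v v) + (if g = Gen_a then 2 else 0)"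
    unfolding eq x by (auto simp: H_def)
  have dist: "distinct (heights h\<^sub>u u)" "distinct (heights h\<^sub>v v)"
      "set (heights h\<^sub>u u) \<inter> set (heights h\<^sub>v v) = {}"
      "H \<inter> (set (heights h\<^sub>u u) \<union> set (heights h\<^sub>v v)) = {}" "g = Gen_a \<Longrightarrow> h \<noteq> h\<^sub>v"
    using Pair.prems(2) unfolding eq x H_def by (cases "g = Gen_a"; force)+
  have X: "set (heights h\<^sub>u u) \<subseteq> X" "set (heights h\<^sub>v v) \<subseteq> X" "H \<subseteq> X" 
    using Pair.prems(3) unfolding set by blast+
  obtain P Q where u: "P \<union> Q \<subseteq> set (heights h\<^sub>u u)" "P \<inter> Q = {}"
      "int (length (heights h\<^sub>u u)) + \<bar>shift u - (\<Sum>P - \<Sum>Q)\<bar> \<le> int k"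
    using Pair.IH(1)[OF Pair.prems(1) dist(1) X(1)] by blast
  obtain P' Q' where v: "P' \<union> Q' \<subseteq> set (heights h\<^sub>v v)" "P' \<inter> Q' = {}"
      "int (length (heights h\<^sub>v v)) + \<bar>shift v - (\<Sum>P' - \<Sum>Q')\<bar> \<le> int l"
    using Pair.IH(2)[OF Pair.prems(1) dist(2) X(2)] by blast
  have fin: "finite P" "finite Q" "finite P'" "finite Q'"
    using u(1) v(1) by (metis List.finite_set Un_subset_iff finite_subset)+
  show ?case
  proof (cases g)
    case Gen_a
    \<comment> \<open>The shift of \<open>u\<close> is the difference of the heights of the pair that encloses it.\<close>
    have "2 \<le> \<bar>\<Sum>(insert h\<^sub>v Q) - \<Sum>(insert h P)\<bar>"
    proof (rule sparseD[OF Pair.prems(1)])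
      show "insert h\<^sub>v Q \<union> insert h P \<subseteq> X" using X u(1) Gen_a by (auto simp: H_def)
      show "insert h\<^sub>v Q \<inter> insert h P = {}" using u(1,2) dist Gen_a by (auto simp: H_def)
    qed (use fin in auto)
    moreover have "h\<^sub>v \<notin> Q" "h \<notin> P" using u(1) dist(4) Gen_a by (auto simp: H_def)
    ultimately have "2 \<le> \<bar>shift u - (\<Sum>P - \<Sum>Q)\<bar>"
      using fin by (simp add: h\<^sub>v_def algebra_simps)
    define R where "R = insert h\<^sub>v P'"
    define S where "S = insert h Q'"
    have "h\<^sub>v \<notin> P'" "h \<notin> Q'" using v(1) dist(4) Gen_a by (auto simp: H_def)
    then have "\<Sum>R - \<Sum>S = shift u + (\<Sum>P' - \<Sum>Q')"
      using fin by (simp add: R_def S_def h\<^sub>v_def)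
    moreover have "R \<inter> S = {}" "R \<union> S \<subseteq> set (heights h (x # u @ inv_letter x # v))"
      unfolding set using v(1,2) dist Gen_a by (auto simp: R_def S_def H_def)
    ultimately show ?thesis
      using u(3) v(3) \<open>2 \<le> \<bar>shift u - (\<Sum>P - \<Sum>Q)\<bar>\<close> Gen_a unfolding len sh
      by (intro exI[of _ R] exI[of _ S]) auto
  next
    case Gen_b
    have "\<Sum>(P \<union> P') = \<Sum>P + \<Sum>P'" "\<Sum>(Q \<union> Q') = \<Sum>Q + \<Sum>Q'"
      using u(1) v(1) dist(3) fin by (intro sum.union_disjoint; blast)+
    moreover have "(P \<union> P') \<inter> (Q \<union> Q') = {}" "(P \<union> P') \<union> (Q \<union> Q') \<subseteq> set (heights h (x # u @ inv_letter x # v))"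
      unfolding set using u(1,2) v(1,2) dist(3) by blast+
    ultimately show ?thesis
      using u(3) v(3) Gen_b unfolding len sh
      by (intro exI[of _ "P \<union> P'"] exI[of _ "Q \<union> Q'"]) auto
  qed
qed

lemma F2_gens_letters: "F2_gens = range (\<lambda>x. [x])"
  using F2_letter_in_gens by (auto simp: F2_gens_eq)

text \<open>With distinct sparse heights, every letter \<open>a\<^sup>\<plusminus>\<^sup>1\<close> costs a deletion: its own, or that of a letter
\<open>b\<^sup>\<plusminus>\<^sup>1\<close> that its cancellation requires.\<close>

lemma biinv_norm_ge_number_of_heights:
  assumes "sparse X" "distinct (heights 0 w)" "set (heights 0 w) \<subseteq> X"
  shows "length (heights 0 w) \<le> biinv_norm F2 F2_gens (word_value w)"
proof -
  have product: "\<exists>k ss. length ss = k \<and> set ss \<subseteq> conj_closure F2 F2_gens \<and>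
      word_value w = foldr (\<otimes>\<^bsub>F2\<^esub>) ss \<one>\<^bsub>F2\<^esub>"
  proof (intro exI conjI)
    let ?ss = "map (\<lambda>x. [x]) (word_value w)"
    show "word_value w = foldr (\<otimes>\<^bsub>F2\<^esub>) ?ss \<one>\<^bsub>F2\<^esub>"
      by (rule F2_generated) (simp add: reduced_foldr)
    have "s \<in> conj_closure F2 F2_gens" if "s \<in> F2_gens" for s
    proof -
      have "s = \<one>\<^bsub>F2\<^esub> \<otimes>\<^bsub>F2\<^esub> s \<otimes>\<^bsub>F2\<^esub> inv\<^bsub>F2\<^esub> \<one>\<^bsub>F2\<^esub>"
        using that F2_gens_closed by (simp add: subset_iff)
      then show ?thesis using that F2.one_closed unfolding conj_closure_def by blast
    qed
    then show "set ?ss \<subseteq> conj_closure F2 F2_gens" by (auto simp: F2_gens_letters)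
  qed (rule refl)
  obtain ss where ss: "length ss = biinv_norm F2 F2_gens (word_value w)"
      "set ss \<subseteq> conj_closure F2 F2_gens" "word_value w = foldr (\<otimes>\<^bsub>F2\<^esub>) ss \<one>\<^bsub>F2\<^esub>"
    unfolding biinv_norm_def using LeastI_ex[OF product] by blast
  then have "cancels (biinv_norm F2 F2_gens (word_value w)) w"
    using cancels_product_of_conjugates[of ss w] by (simp add: F2_gens_letters)
  from cancels_signed_sum[OF this assms] show ?thesis by fastforce
qed

section \<open>Potentials on trees\<close>

lemma adj_commute: "adj E u v \<longleftrightarrow> adj E v u"
  by (simp add: adj_def insert_commute)

lemma connected_graph_walk:
  assumes "connected_graph V E" "u \<in> V" "v \<in> V"
  obtains ws where "ws \<noteq> []" "successively (adj E) ws" "hd ws = u" "last ws = v"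
proof -
  have "(adj E)\<^sup>*\<^sup>* u v" using assms by (simp add: connected_graph_def)
  then have "\<exists>ws. ws \<noteq> [] \<and> successively (adj E) ws \<and> hd ws = u \<and> last ws = v"
  proof (induction rule: converse_rtranclp_induct)
    case base
    show ?case by (rule exI[of _ "[v]"]) simp
  next
    case (step u w)
    then obtain ws where "successively (adj E) ws" "ws \<noteq> []" "hd ws = w" "last ws = v" by blast
    with step(1) show ?case by (intro exI[of _ "u # ws"]) (auto simp: successively_Cons)
  qed
  then show ?thesis using that by blast
qed

text \<open>A first return of a walk to one of its vertices closes a cycle, unless the walk has taken an edge
back and forth.\<close>

lemma acyclic_walk_backtracks:
  assumes "acyclic_graph E" "simple_graph V E" "successively (adj E) ws" "\<not> distinct ws"
  shows "\<exists>ps x y qs. ws = ps @ [x, y, x] @ qs"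
  using assms(3,4)
proof (induction ws)
  case (Cons x ws)
  show ?case
  proof (cases "distinct ws")
    case False
    with Cons obtain ps x' y qs where "ws = ps @ [x', y, x'] @ qs" by (auto simp: successively_Cons)
    then show ?thesis by (intro exI[of _ "x # ps"]) auto
  next
    case True
    with Cons.prems obtain ps qs where ws: "ws = ps @ x # qs" by (auto dest: split_list)
    have cycle: "distinct (x # ps)" "successively (adj E) (x # ps)"
      "adj E (last (x # ps)) x"
      using Cons.prems True ws
      by (cases ps; auto simp: successively_append_iff successively_Cons split: if_splits)+
    have "length ps < 2"
    proof (rule ccontr)
      assume "\<not> length ps < 2"
      then have "length (x # ps) \<ge> 3" by simp
      moreover have "adj E (last (x # ps)) (hd (x # ps))" using cycle(3) by simp
      ultimately show False using assms(1) cycle(1,2) unfolding acyclic_graph_def by blast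
    qed
    moreover have "ps \<noteq> []" using cycle(3) edge_cell(6)[OF assms(2)] by fastforce
    ultimately obtain y where "ps = [y]" by (cases ps; cases "tl ps") auto
    then show ?thesis using ws by (intro exI[of _ "[]"]) auto
  qed
qed simp

fun holonomy :: "('a, 'b) monoid_scheme \<Rightarrow> ('v \<Rightarrow> 'v \<Rightarrow> 'a) \<Rightarrow> 'v list \<Rightarrow> 'a" where
  "holonomy G s (u # v # ws) = s u v \<otimes>\<^bsub>G\<^esub> holonomy G s (v # ws)"
| "holonomy G s _ = \<one>\<^bsub>G\<^esub>"

context group
begin

context
  fixes E :: "'v set set" and s :: "'v \<Rightarrow> 'v \<Rightarrow> 'a"
  assumes s_closed: "\<And>u v. adj E u v \<Longrightarrow> s u v \<in> carrier G"
    and s_inverse: "\<And>u v. adj E u v \<Longrightarrow> s v u = inv (s u v)"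
begin

lemma holonomy_closed: "successively (adj E) ws \<Longrightarrow> holonomy G s ws \<in> carrier G"
  by (induction ws rule: induct_list012) (auto intro: s_closed)

lemma holonomy_append:
  "successively (adj E) (us @ w # vs) \<Longrightarrow>
    holonomy G s (us @ w # vs) = holonomy G s (us @ [w]) \<otimes> holonomy G s (w # vs)"
proof (induction us rule: induct_list012)
  case (2 x)
  then have "adj E x w" "successively (adj E) (w # vs)" by auto
  then show ?case by (simp add: s_closed holonomy_closed)
next
  case (3 x y us)
  have "successively (adj E) (y # us @ [w])" "successively (adj E) (w # vs)" "adj E x y"
    using 3(3) successively_append_iff[of "adj E" "y # us" "w # vs"]
      successively_append_iff[of "adj E" "y # us" "[w]"] by simp_all
  with 3 show ?case
    by (auto simp: m_assoc s_closed holonomy_closed[of "y # us @ [w]", simplified] holonomy_closed)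
qed (simp add: holonomy_closed)

lemma holonomy_rev:
  "successively (adj E) ws \<Longrightarrow> holonomy G s (rev ws) = inv (holonomy G s ws)"
proof (induction ws rule: induct_list012)
  case (3 x y ws)
  then have xy: "adj E x y" "successively (adj E) (y # ws)" by auto
  have "successively (adj E) (rev (x # y # ws))"
    using 3(3) by (simp only: successively_rev adj_commute[of E])
  then have "successively (adj E) (rev ws @ y # [x])" by simp
  from holonomy_append[OF this] show ?case
    using 3(2) xy s_closed s_inverse[of x y] holonomy_closed adj_commute[of E]
    by (simp add: inv_mult_group)
qed simp_all

text \<open>A closed walk with an edge repeats a vertex and therefore backtracks; the labels of the two opposite
steps cancel, and removing both steps gives a shorter closed walk.\<close>

lemma closed_walk_holonomy:
  assumes "acyclic_graph E" "simple_graph V E"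
    and "successively (adj E) ws" "ws \<noteq> []" "hd ws = last ws"
  shows "holonomy G s ws = \<one>"
  using assms(3-)
proof (induction "length ws" arbitrary: ws rule: less_induct)
  case less
  show ?case
  proof (cases "distinct ws")
    case True
    with less.prems obtain w where "ws = [w]" by (cases ws) (auto split: if_splits)
    then show ?thesis by simp
  next
    case False
    from acyclic_walk_backtracks[OF assms(1,2) less.prems(1) this]
    obtain ps x y qs where ws: "ws = ps @ x # y # x # qs" by auto
    have w: "successively (adj E) (ps @ [x])" "adj E x y" "adj E y x" "successively (adj E) (x # qs)"
      "successively (adj E) (ps @ x # qs)"
      using less.prems(1) unfolding ws by (auto simp: successively_append_iff successively_Cons)
    have "holonomy G s (x # y # x # qs) = holonomy G s (x # qs)"
      using w s_closed s_inverse[of x y] holonomy_closed[OF w(4)] by (simp add: m_assoc[symmetric])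
    then have "holonomy G s ws = holonomy G s (ps @ x # qs)"
      using holonomy_append[of ps x qs] holonomy_append[of ps x "y # x # qs"] less.prems(1) w(5)
      unfolding ws by simp
    also have "\<dots> = \<one>"
      by (rule less.hyps) (use less.prems w(5) ws in \<open>auto simp: hd_append\<close>)
    finally show ?thesis .
  qed
qed

text \<open>Labels that are inverted when an edge is reversed have a potential on a tree: its value at \<open>v\<close> is the
holonomy of any walk from \<open>v\<close> to a fixed root.\<close>

lemma acyclic_graph_potential:
  assumes "tree_graph V E"
  shows "\<exists>F. (\<forall>v\<in>V. F v \<in> carrier G) \<and> (\<forall>u v. adj E u v \<longrightarrow> F u = s u v \<otimes> F v)"
proof -
  have ac: "acyclic_graph E" and sg: "simple_graph V E" and "connected_graph V E"
    using assms by (auto simp: tree_graph_def connected_graph_def)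
  then obtain r where r: "r \<in> V" unfolding connected_graph_def by blast
  have "\<exists>ws. successively (adj E) ws \<and> ws \<noteq> [] \<and> hd ws = v \<and> last ws = r" if "v \<in> V" for v
    using connected_graph_walk[OF \<open>connected_graph V E\<close> that r] by blast
  then obtain W where W: "\<And>v. v \<in> V \<Longrightarrow> successively (adj E) (W v) \<and> W v \<noteq> [] \<and> hd (W v) = v \<and> last (W v) = r"
    by metis
  define F where "F v = holonomy G s (W v)" for v
  have F_closed: "F v \<in> carrier G" if "v \<in> V" for v
    using W[OF that] holonomy_closed by (simp add: F_def)
  have "F u = s u v \<otimes> F v" if uv: "adj E u v" for u v
  proof -
    have "u \<in> V" "v \<in> V" using edge_cell(4,5)[OF sg uv] by auto
    then obtain us vs where us: "W u = us @ [r]" and vs: "W v = v # vs" "last (v # vs) = r"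
      using W by (metis append_butlast_last_id list.collapse)
    have wu: "successively (adj E) (us @ [r])" "hd (us @ [r]) = u"
      and wv: "successively (adj E) (v # vs)"
      using W[OF \<open>u \<in> V\<close>] W[OF \<open>v \<in> V\<close>] us vs by auto
    have wuv: "successively (adj E) (u # v # vs)" using uv wv by simp
    have wr: "successively (adj E) (rev (us @ [r]))"
      using wu(1) by (simp only: successively_rev adj_commute[of E])
    \<comment> \<open>The closed walk from \<open>u\<close> across the edge to \<open>v\<close>, on to the root and back to \<open>u\<close>.\<close>
    define C where "C = butlast (u # v # vs) @ r # rev us"
    have C: "u # v # vs = butlast (u # v # vs) @ [r]"
      using vs(2) by (metis append_butlast_last_id last_ConsR list.distinct(1))
    have "successively (adj E) (butlast (u # v # vs) @ [r])"
      by (rule subst[OF C]) (rule wuv)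
    then have sC: "successively (adj E) C"
      using wr unfolding C_def by (auto simp: successively_append_iff successively_Cons)
    have "last C = u" "hd C = u"
      using wu(2) unfolding C_def by (auto simp: last_rev hd_append split: if_splits)
    then have "holonomy G s C = \<one>"
      using closed_walk_holonomy[OF ac sg sC] by (simp add: C_def)
    then have "holonomy G s (u # v # vs) \<otimes> holonomy G s (rev (us @ [r])) = \<one>"
      using holonomy_append[OF sC[unfolded C_def]] C by (simp add: C_def)
    then have "(s u v \<otimes> F v) \<otimes> inv (F u) = \<one>"
      using holonomy_rev[OF wu(1)] us vs by (simp add: F_def)
    moreover have "F u \<in> carrier G" "F v \<in> carrier G" "s u v \<in> carrier G"
      using \<open>u \<in> V\<close> \<open>v \<in> V\<close> uv s_closed F_closed by auto
    ultimately show ?thesis by (metis inv_closed inv_equality inv_inv m_closed)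
  qed
  then show ?thesis using F_closed by blast
qed

lemma holonomy_potential:
  assumes "successively (adj E) ws" "ws \<noteq> []"
    and "\<And>v. v \<in> set ws \<Longrightarrow> F v \<in> carrier G"
    and "\<And>u v. adj E u v \<Longrightarrow> F u = s u v \<otimes> F v"
  shows "F (hd ws) \<otimes> inv (F (last ws)) = holonomy G s ws"
  using assms(1-3)
proof (induction ws rule: induct_list012)
  case (3 u v ws)
  then have uv: "adj E u v" "successively (adj E) (v # ws)" by auto
  have "last (v # ws) \<in> set (v # ws)" by (rule last_in_set) simp
  then have "F v \<in> carrier G" "F (last (v # ws)) \<in> carrier G" using 3(5) by auto
  then show ?case
    using 3(2) 3(5) uv s_closed[OF uv(1)] assms(4)[OF uv(1)] by (simp add: m_assoc)
qed simp_all

end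

end

section \<open>Locally compact graphs are countable\<close>

lemma coord_le_path_dist:
  assumes "connected_graph V E" "p \<in> realization V E" "q \<in> realization V E"
  shows "\<bar>p v - q v\<bar> \<le> path_dist V E p q"
proof (rule path_dist_greatest[OF assms])
  have s: "simple_graph V E" using assms(1) by (simp add: connected_graph_def)
  fix ps assume "pl_path V E ps" "hd ps = p" "last ps = q"
  then show "\<bar>p v - q v\<bar> \<le> path_length ps"
    using lipschitz_path_length[of V E ps "\<lambda>p. p v"] coord_lipschitz[OF s] by blast
qed

lemma path_dist_le_seg_length:
  assumes "c \<in> cells V E" "p \<in> simplex_on c" "q \<in> simplex_on c"
  shows "path_dist V E p q \<le> seg_length p q"
proof -
  have "pl_path V E [p, q]" using assms by (auto simp: pl_path_def realization_def)
  from path_dist_le[OF this] show ?thesis by simp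
qed

text \<open>The points at a small distance \<open>t\<close> from \<open>v\<close> on the different edges at \<open>v\<close> are pairwise at least \<open>t\<close>
apart. They lie in a compact set, which is totally bounded, so there are only finitely many.\<close>

lemma locally_compact_imp_locally_finite:
  assumes "connected_graph V E"
    and "locally_compact_space (Metric_space.mtopology (realization V E) (path_dist V E))"
    and "v \<in> V"
  shows "finite {u. adj E v u}"
proof -
  interpret Metric_space "realization V E" "path_dist V E"
    by (rule Metric_space_path_dist[OF assms(1)])
  have s: "simple_graph V E" using assms(1) by (simp add: connected_graph_def)
  have "vertex v \<in> topspace mtopology" using assms(3) by (simp add: vertex_in_realization)
  then obtain U K where U: "openin mtopology U" "compactin mtopology K" "vertex v \<in> U" "U \<subseteq> K"
    using assms(2) unfolding locally_compact_space_def by blast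
  then obtain r where r: "r > 0" "mball (vertex v) r \<subseteq> K"
    unfolding openin_mtopology by blast
  \<comment> \<open>Below the radius of the ball, and at most the length of an edge.\<close>
  define t where "t = min r 1 / 2"
  have t: "0 < t" "t \<le> 1" "t < r" using r(1) by (auto simp: t_def)
  define p where "p u = (\<lambda>w. if w = u then t else if w = v then 1 - t else 0)" for u
  have p: "p u \<in> simplex_on {v, u}" "p u \<in> realization V E" "p u \<in> mball (vertex v) r" if "adj E v u" for u
  proof -
    note e = edge_cell[OF s that]
    show 1: "p u \<in> simplex_on {v, u}" using t e(6) by (auto simp: simplex_on_def p_def)
    then show 2: "p u \<in> realization V E" using e(3) by (auto simp: realization_def)
    have "path_dist V E (vertex v) (p u) \<le> seg_length (vertex v) (p u)"
      by (rule path_dist_le_seg_length[OF e(3,1) 1])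
    also have "\<dots> = t" using seg_length_edge[OF e(1) 1 e(6)] t e(6) by (simp add: vertex_def p_def)
    finally show "p u \<in> mball (vertex v) r"
      using t(3) 2 e(4) by (simp add: vertex_in_realization)
  qed
  have "mtotally_bounded K" using U(2) by (rule compactin_imp_mtotally_bounded)
  then obtain C where C: "finite C" "K \<subseteq> (\<Union>x\<in>C. mball x (t / 2))"
    unfolding mtotally_bounded_def using t(1) by (metis half_gt_zero)
  then have "\<forall>u\<in>{u. adj E v u}. \<exists>x\<in>C. p u \<in> mball x (t / 2)" using p(3) r(2) by blast
  then obtain \<gamma> where \<gamma>: "\<And>u. adj E v u \<Longrightarrow> \<gamma> u \<in> C" "\<And>u. adj E v u \<Longrightarrow> p u \<in> mball (\<gamma> u) (t / 2)"
    by (metis mem_Collect_eq)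
  have "inj_on \<gamma> {u. adj E v u}"
  proof (rule inj_onI, rule ccontr)
    fix u w assume uw: "u \<in> {u. adj E v u}" "w \<in> {u. adj E v u}" "\<gamma> u = \<gamma> w" "u \<noteq> w"
    then have u: "adj E v u" and w: "adj E v w" by auto
    have "path_dist V E (p u) (p w) < t"
      using triangle'[of "p u" "\<gamma> u" "p w"] \<gamma>(2)[OF u] \<gamma>(2)[OF w] uw(3) by (auto simp: commute)
    moreover have "\<bar>p u u - p w u\<bar> = t"
      using uw(4) t edge_cell(6)[OF s u] by (simp add: p_def)
    ultimately show False
      using coord_le_path_dist[OF assms(1) p(2)[OF u] p(2)[OF w], of u] by simp
  qed
  moreover have "\<gamma> ` {u. adj E v u} \<subseteq> C" using \<gamma>(1) by auto
  ultimately show ?thesis using C(1) by (metis finite_imageD finite_subset)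
qed

lemma locally_finite_imp_countable:
  assumes "connected_graph V E" "\<And>v. v \<in> V \<Longrightarrow> finite {u. adj E v u}"
  shows "countable V"
proof -
  have s: "simple_graph V E" using assms(1) by (simp add: connected_graph_def)
  obtain r where r: "r \<in> V" using assms(1) by (auto simp: connected_graph_def)
  have "finite {v. (adj E ^^ n) r v} \<and> {v. (adj E ^^ n) r v} \<subseteq> V" for n
  proof (induction n)
    case 0
    then show ?case using r by simp
  next
    case (Suc n)
    have "{v. (adj E ^^ Suc n) r v} = (\<Union>u\<in>{u. (adj E ^^ n) r u}. {v. adj E u v})" by auto
    then show ?case using Suc assms(2) edge_cell(5)[OF s] by auto
  qed
  then have "countable (\<Union>n. {v. (adj E ^^ n) r v})" by (simp add: countable_finite)
  moreover have "V \<subseteq> (\<Union>n. {v. (adj E ^^ n) r v})"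
  proof
    fix v assume "v \<in> V"
    then have "(adj E)\<^sup>*\<^sup>* r v" using assms(1) r by (simp add: connected_graph_def)
    then show "v \<in> (\<Union>n. {v. (adj E ^^ n) r v})" by (auto dest: rtranclp_imp_relpowp)
  qed
  ultimately show ?thesis by (rule countable_subset[rotated])
qed

section \<open>Embedding the vertices of a countable tree\<close>

definition edge_word :: "nat \<Rightarrow> bool \<Rightarrow> gen letter list" where
  "edge_word n e = replicate n (Gen_b, True) @ (Gen_a, e) # replicate n (Gen_b, False)"

lemma inverse_edge_word: "inverse_word (edge_word n e) = edge_word n (\<not> e)"
  by (simp add: edge_word_def inv_letter_def)

lemma shift_edge_word: "shift (edge_word n e) = 0"
proof -
  have "shift (replicate n (Gen_b, e)) = (if e then int n else - int n)" for n e
    by (induction n) auto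
  then show ?thesis by (simp add: edge_word_def shift_append)
qed

lemma heights_edge_word: "heights h (edge_word n e) = [h + int n]"
proof -
  have "heights h (replicate n (Gen_b, e)) = []" for h n e
    by (induction n arbitrary: h) auto
  moreover have "shift (replicate n (Gen_b, True)) = int n" for n
    by (induction n) auto
  ultimately show ?thesis by (simp add: edge_word_def heights_append)
qed

lemma edge_word_in_conj_closure: "word_value (edge_word n e) \<in> conj_closure F2 F2_gens"
proof -
  define y where "y = replicate n (Gen_b, True)"
  have "edge_word n e = y @ [(Gen_a, e)] @ inverse_word y"
    by (simp add: edge_word_def y_def inv_letter_def)
  moreover have "word_value [(Gen_a, e)] = [(Gen_a, e)]" "[(Gen_a, e)] \<in> carrier F2"
    using F2_gens_closed F2_letter_in_gens by auto
  ultimately have "word_value (edge_word n e) =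
      word_value y \<otimes>\<^bsub>F2\<^esub> [(Gen_a, e)] \<otimes>\<^bsub>F2\<^esub> inv\<^bsub>F2\<^esub> (word_value y)"
    by (simp only: word_value_append word_value_inverse F2.m_assoc F2.inv_closed word_value_reduced)
  then show ?thesis
    using word_value_reduced F2_letter_in_gens unfolding conj_closure_def by blast
qed

fun walk_edges :: "'v list \<Rightarrow> 'v set list" where
  "walk_edges (u # v # ws) = {u, v} # walk_edges (v # ws)"
| "walk_edges _ = []"

lemma length_walk_edges: "length (walk_edges ws) = length ws - 1"
  by (induction ws rule: walk_edges.induct) auto

lemma walk_edges_subset: "e \<in> set (walk_edges ws) \<Longrightarrow> e \<subseteq> set ws"
  by (induction ws rule: walk_edges.induct) auto

lemma walk_edges_in: "successively (adj E) ws \<Longrightarrow> set (walk_edges ws) \<subseteq> E"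
  by (induction ws rule: walk_edges.induct) (auto simp: adj_def)

lemma distinct_walk_edges: "distinct ws \<Longrightarrow> distinct (walk_edges ws)"
proof (induction ws rule: walk_edges.induct)
  case (1 u v ws)
  then have "{u, v} \<notin> set (walk_edges (v # ws))" using walk_edges_subset by fastforce
  with 1 show ?case by simp
qed auto

lemma countable_edges:
  assumes "simple_graph V E" "countable V"
  shows "countable E"
proof -
  have "E \<subseteq> (\<lambda>(u, v). {u, v}) ` (V \<times> V)"
  proof
    fix e assume "e \<in> E"
    then have "e \<subseteq> V" "card e = 2" using assms(1) by (auto simp: simple_graph_def)
    then obtain u v where "e = {u, v}" by (auto simp: card_2_iff)
    then show "e \<in> (\<lambda>(u, v). {u, v}) ` (V \<times> V)" using \<open>e \<subseteq> V\<close> by auto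
  qed
  then show ?thesis using assms(2) by (meson countable_SIGMA countable_image countable_subset)
qed

text \<open>The edges are labelled by the conjugates \<open>b\<^sup>N a\<^sup>\<plusminus>\<^sup>1 b\<^sup>-\<^sup>N\<close>, where \<open>N\<close> is a power of \<open>3\<close> that belongs to the
edge and an enumeration of the vertices orients the edge and decides the sign. Let \<open>F\<close> be a potential.
Along a walk without repeated vertices no edge occurs twice, so the word that spells the holonomy has
distinct powers of \<open>3\<close> as heights.\<close>

lemma countable_tree_vertex_embedding:
  fixes V :: "'v set"
  assumes "tree_graph V E" "countable V"
  obtains F where "\<And>v. v \<in> V \<Longrightarrow> F v \<in> carrier F2"
    and "\<And>u v. adj E u v \<Longrightarrow> F u \<otimes>\<^bsub>F2\<^esub> inv\<^bsub>F2\<^esub> (F v) \<in> conj_closure F2 F2_gens"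
    and "\<And>ws. ws \<noteq> [] \<Longrightarrow> set ws \<subseteq> V \<Longrightarrow> successively (adj E) ws \<Longrightarrow> distinct ws \<Longrightarrow>
      length ws - 1 \<le> biinv_dist F2 F2_gens (F (hd ws)) (F (last ws))"
proof -
  have sg: "simple_graph V E" using assms(1) by (simp add: tree_graph_def connected_graph_def)
  have "countable E" by (rule countable_edges[OF sg assms(2)])
  define N :: "'v set \<Rightarrow> nat" where "N e = 3 ^ Suc (to_nat_on E e)" for e
  define w where "w u v = edge_word (N {u, v}) (to_nat_on V u < to_nat_on V v)" for u v
  define s where "s u v = word_value (w u v)" for u v
  have s_closed: "s u v \<in> carrier F2" for u v by (simp only: s_def word_value_reduced)
  have s_inverse: "s v u = inv\<^bsub>F2\<^esub> (s u v)" if "adj E u v" for u v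
  proof -
    have "to_nat_on V u \<noteq> to_nat_on V v"
      using edge_cell(4-6)[OF sg that] inj_on_to_nat_on[OF assms(2)] by (auto dest: inj_onD)
    then have "to_nat_on V v < to_nat_on V u \<longleftrightarrow> \<not> to_nat_on V u < to_nat_on V v" by linarith
    then have "w v u = inverse_word (w u v)"
      by (simp only: w_def inverse_edge_word insert_commute)
    then show ?thesis by (simp only: s_def word_value_inverse)
  qed
  obtain F where "(\<forall>v\<in>V. F v \<in> carrier F2) \<and> (\<forall>u v. adj E u v \<longrightarrow> F u = s u v \<otimes>\<^bsub>F2\<^esub> F v)"
    using F2.acyclic_graph_potential[of E s, OF s_closed s_inverse assms(1)] ..
  then have F_closed: "\<And>v. v \<in> V \<Longrightarrow> F v \<in> carrier F2"
    and F: "\<And>u v. adj E u v \<Longrightarrow> F u = s u v \<otimes>\<^bsub>F2\<^esub> F v"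
    by blast+
  have F_walk: "F (hd ws) \<otimes>\<^bsub>F2\<^esub> inv\<^bsub>F2\<^esub> (F (last ws)) = holonomy F2 s ws"
    if "ws \<noteq> []" "set ws \<subseteq> V" "successively (adj E) ws" for ws
    using that(2) F_closed
    by (intro F2.holonomy_potential[OF s_closed s_inverse that(3,1) _ F]) auto
  show ?thesis
  proof (rule that)
    show "F v \<in> carrier F2" if "v \<in> V" for v using that by (rule F_closed)
    show "F u \<otimes>\<^bsub>F2\<^esub> inv\<^bsub>F2\<^esub> (F v) \<in> conj_closure F2 F2_gens" if "adj E u v" for u v
      using F_walk[of "[u, v]"] edge_cell(4,5)[OF sg that] that s_closed[of u v]
        edge_word_in_conj_closure[of "N {u, v}"] by (simp add: s_def w_def)
    show "length ws - 1 \<le> biinv_dist F2 F2_gens (F (hd ws)) (F (last ws))"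
      if ws: "ws \<noteq> []" "set ws \<subseteq> V" "successively (adj E) ws" "distinct ws" for ws
    proof -
      have "\<exists>W. word_value W = holonomy F2 s ws \<and> shift W = 0 \<and>
          heights 0 W = map (\<lambda>e. 3 ^ Suc (to_nat_on E e)) (walk_edges ws)" for ws
      proof (induction ws rule: walk_edges.induct)
        case (1 u v ws)
        then obtain W where W: "word_value W = holonomy F2 s (v # ws)" "shift W = 0"
            "heights 0 W = map (\<lambda>e. 3 ^ Suc (to_nat_on E e)) (walk_edges (v # ws))" by blast
        have "word_value (w u v @ W) = holonomy F2 s (u # v # ws)"
          unfolding word_value_append W(1) by (simp add: s_def)
        with W show ?case
          by (intro exI[of _ "w u v @ W"])
            (simp add: w_def N_def shift_append shift_edge_word heights_append heights_edge_word)
      qed (auto simp: free_group_def intro!: exI[of _ "[]"])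
      then obtain W where W: "word_value W = holonomy F2 s ws"
          "heights 0 W = map (\<lambda>e. 3 ^ Suc (to_nat_on E e)) (walk_edges ws)" by blast
      have "inj_on (to_nat_on E) (set (walk_edges ws))"
        using walk_edges_in[OF ws(3)] inj_on_to_nat_on[OF \<open>countable E\<close>] by (rule inj_on_subset[rotated])
      then have "distinct (heights 0 W)"
        using distinct_walk_edges[OF ws(4)] unfolding W(2) distinct_map
        by (auto simp: inj_on_def)
      then have "length (heights 0 W) \<le> biinv_norm F2 F2_gens (word_value W)"
        by (rule biinv_norm_ge_number_of_heights[OF sparse_powers_of_3]) (auto simp: W(2))
      then show ?thesis
        using F_walk[OF ws(1-3)] by (simp add: W biinv_dist_def length_walk_edges)
    qed
  qed
qed

section \<open>Extending a map of vertices to the edges\<close>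

text \<open>For injective \<open>F\<close>, this is the affine extension of \<open>F\<close> over the edges.\<close>

definition push :: "'v set \<Rightarrow> ('v \<Rightarrow> 'w) \<Rightarrow> ('v \<Rightarrow> real) \<Rightarrow> 'w \<Rightarrow> real" where
  "push V F p = (\<lambda>g. if g \<in> F ` V then p (inv_into V F g) else 0)"

lemma push_apply: "inj_on F V \<Longrightarrow> v \<in> V \<Longrightarrow> push V F p (F v) = p v"
  by (simp add: push_def)

lemma push_in_simplex:
  assumes "inj_on F V" "c \<subseteq> V" "p \<in> simplex_on c"
  shows "push V F p \<in> simplex_on (F ` c)"
proof -
  have "(\<Sum>g\<in>F ` c. push V F p g) = (\<Sum>v\<in>c. push V F p (F v))"
    using inj_on_subset[OF assms(1,2)] by (simp add: sum.reindex)
  also have "\<dots> = (\<Sum>v\<in>c. p v)"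
    using assms(1,2) by (intro sum.cong) (auto simp: push_apply subset_iff)
  also have "\<dots> = 1" using assms(3) by (simp add: simplex_on_def)
  moreover have "push V F p g = 0" if "g \<notin> F ` c" for g
  proof (cases "g \<in> F ` V")
    case True
    then obtain v where "v \<in> V" "g = F v" by auto
    with that assms show ?thesis by (auto simp: push_apply simplex_on_def)
  qed (simp add: push_def)
  moreover have "0 \<le> push V F p g" for g
    using assms(3) by (simp add: push_def simplex_on_def)
  ultimately show ?thesis by (simp add: simplex_on_def)
qed

lemma push_vertex:
  assumes "inj_on F V" "v \<in> V"
  shows "push V F (vertex v) = vertex (F v)"
  using push_in_simplex[of F V "{v}" "vertex v"] assms by (simp add: simplex_singleton)

lemma seg_length_push:
  assumes "inj_on F V" "c \<subseteq> V" "finite c" "p \<in> simplex_on c" "q \<in> simplex_on c"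
  shows "seg_length (push V F p) (push V F q) = seg_length p q"
proof -
  have "(\<Sum>g\<in>F ` c. \<bar>push V F p g - push V F q g\<bar>) = (\<Sum>v\<in>c. \<bar>p v - q v\<bar>)"
    using inj_on_subset[OF assms(1,2)] assms(1,2)
    by (auto simp: sum.reindex push_apply subset_iff intro!: sum.cong)
  then show ?thesis
    using simplex_seg_length[OF assms(4,5,3)]
      simplex_seg_length[OF push_in_simplex[OF assms(1,2,4)] push_in_simplex[OF assms(1,2,5)]] assms(3)
    by simp
qed

context
  fixes V :: "'v set" and E :: "'v set set" and V' :: "'w set" and E' :: "'w set set"
    and F :: "'v \<Rightarrow> 'w"
  assumes graph: "connected_graph V E" and inj: "inj_on F V" and F_vertex: "F ` V \<subseteq> V'"
    and F_edge: "\<And>u v. adj E u v \<Longrightarrow> adj E' (F u) (F v)"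
begin

lemma cells_finite_subset: "c \<in> cells V E \<Longrightarrow> finite c \<and> c \<subseteq> V"
  using graph by (auto simp: connected_graph_def elim: cells_cases)

lemma image_in_cells:
  assumes "c \<in> cells V E"
  shows "F ` c \<in> cells V' E'"
proof -
  have "simple_graph V E" using graph by (simp add: connected_graph_def)
  from this assms show ?thesis
  proof (cases rule: cells_cases)
    case (1 v)
    then show ?thesis using F_vertex by (auto simp: cells_def)
  next
    case (2 a b)
    then show ?thesis using F_edge[of a b] by (simp add: cells_def adj_def)
  qed
qed

lemma push_in_realization:
  assumes "p \<in> realization V E"
  shows "push V F p \<in> realization V' E'"
proof -
  obtain c where c: "c \<in> cells V E" "p \<in> simplex_on c" using assms by (auto simp: realization_def)
  then have "push V F p \<in> simplex_on (F ` c)" using push_in_simplex[OF inj] cells_finite_subset by simp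
  then show ?thesis using image_in_cells[OF c(1)] by (auto simp: realization_def)
qed

lemma pl_path_push:
  assumes "pl_path V E ps"
  shows "pl_path V' E' (map (push V F) ps) \<and> path_length (map (push V F) ps) = path_length ps"
  using assms
proof (induction ps rule: path_length.induct)
  case (1 p q ps)
  then obtain c where c: "c \<in> cells V E" "p \<in> simplex_on c" "q \<in> simplex_on c"
    by (auto simp: pl_path_def)
  have "pl_path V E (q # ps)" using 1(2) by (simp add: pl_path_def)
  with 1 have IH: "pl_path V' E' (map (push V F) (q # ps))"
      "path_length (map (push V F) (q # ps)) = path_length (q # ps)" by auto
  have "push V F p \<in> realization V' E'" using 1(2) push_in_realization by (simp add: pl_path_def)
  moreover have "F ` c \<in> cells V' E'" "push V F p \<in> simplex_on (F ` c)" "push V F q \<in> simplex_on (F ` c)"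
    using c image_in_cells push_in_simplex[OF inj] cells_finite_subset by auto
  ultimately show ?case
    using IH seg_length_push[OF inj _ _ c(2,3)] cells_finite_subset[OF c(1)]
    by (auto simp: pl_path_def)
qed (auto simp: pl_path_def push_in_realization)

lemma path_dist_push_le:
  assumes "p \<in> realization V E" "q \<in> realization V E"
  shows "path_dist V' E' (push V F p) (push V F q) \<le> path_dist V E p q"
proof (rule path_dist_greatest[OF graph assms])
  fix ps assume ps: "pl_path V E ps" "hd ps = p" "last ps = q"
  then have "hd (map (push V F) ps) = push V F p" "last (map (push V F) ps) = push V F q"
    by (auto simp: pl_path_def hd_map last_map)
  then show "path_dist V' E' (push V F p) (push V F q) \<le> path_length ps"
    using path_dist_le[of V' E' "map (push V F) ps"] pl_path_push[OF ps(1)] by auto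
qed

end

text \<open>The affine extension of a function on the vertices; the sum over the support is finite on the
realization.\<close>

definition interpolation :: "('v \<Rightarrow> real) \<Rightarrow> ('v \<Rightarrow> real) \<Rightarrow> real" where
  "interpolation D p = (\<Sum>v | p v \<noteq> 0. p v * D v)"

lemma interpolation_edge:
  assumes "p \<in> simplex_on {a, b}" "a \<noteq> b"
  shows "interpolation D p = p a * D a + p b * D b"
proof -
  have "interpolation D p = (\<Sum>v\<in>{a, b}. p v * D v)"
    unfolding interpolation_def using assms by (intro sum.mono_neutral_left) (auto simp: simplex_on_def)
  then show ?thesis using assms(2) by simp
qed

lemma interpolation_lipschitz:
  assumes "connected_graph V E" "\<And>u v. adj E u v \<Longrightarrow> \<bar>D u - D v\<bar> \<le> 1"
    and "p \<in> realization V E" "q \<in> realization V E"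
  shows "\<bar>interpolation D p - interpolation D q\<bar> \<le> path_dist V E p q"
proof (rule path_dist_greatest[OF assms(1,3,4)])
  have s: "simple_graph V E" using assms(1) by (simp add: connected_graph_def)
  have lip: "\<bar>interpolation D p - interpolation D q\<bar> \<le> seg_length p q"
    if "c \<in> cells V E" "p \<in> simplex_on c" "q \<in> simplex_on c" for c p q
    using s that(1)
  proof (cases rule: cells_cases)
    case (1 v)
    with that show ?thesis by (simp add: simplex_singleton)
  next
    case (2 a b)
    have eq: "p b = 1 - p a" "q b = 1 - q a" using that 2 by (auto simp: simplex_on_def)
    have "interpolation D p = p a * D a + p b * D b" "interpolation D q = q a * D a + q b * D b"
      using interpolation_edge[of p a b D] interpolation_edge[of q a b D] that 2 by simp_all
    then have "interpolation D p - interpolation D q = (p a - q a) * (D a - D b)"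
      unfolding eq by (simp add: algebra_simps)
    then have "\<bar>interpolation D p - interpolation D q\<bar> = \<bar>p a - q a\<bar> * \<bar>D a - D b\<bar>"
      by (simp add: abs_mult)
    also have "\<dots> \<le> \<bar>p a - q a\<bar>" using assms(2)[of a b] 2 by (simp add: adj_def mult_left_le)
    finally show ?thesis using seg_length_edge[of p a b q] that 2 by simp
  qed
  fix ps assume "pl_path V E ps" "hd ps = p" "last ps = q"
  then show "\<bar>interpolation D p - interpolation D q\<bar> \<le> path_length ps"
    using lipschitz_path_length[of V E ps "interpolation D", OF _ lip] by auto
qed

section \<open>Walks between two edges of a graph\<close>

lemma walk_relpowp:
  "successively (adj E) ws \<Longrightarrow> ws \<noteq> [] \<Longrightarrow> (adj E ^^ (length ws - 1)) (hd ws) (last ws)"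
proof (induction ws rule: induct_list012)
  case (3 x y ws)
  then have "adj E x y" "(adj E ^^ length ws) y (last (y # ws))" by auto
  from relpowp_Suc_I2[OF this] show ?case by (simp del: relpowp.simps)
qed auto

lemma walk_in_vertices:
  assumes "simple_graph V E" "successively (adj E) ws" "hd ws \<in> V"
  shows "set ws \<subseteq> V"
  using assms(2,3)
proof (induction ws rule: induct_list012)
  case (3 x y ws)
  then show ?case using edge_cell(5)[OF assms(1), of x y] by auto
qed auto

text \<open>A walk of minimal length among all walks from \<open>A\<close> to \<open>B\<close> can be shortened neither at a repeated
vertex nor at a later visit to \<open>A\<close> or an earlier visit to \<open>B\<close>, and it stays at a common vertex of
\<open>A\<close> and \<open>B\<close> if there is one.\<close>

lemma shortest_walk:
  assumes "connected_graph V E" "A \<subseteq> V" "B \<subseteq> V" "A \<noteq> {}" "B \<noteq> {}"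
  obtains ws where "ws \<noteq> []" "successively (adj E) ws" "hd ws \<in> A" "last ws \<in> B" "distinct ws"
    "set (tl ws) \<inter> A = {}" "set (butlast ws) \<inter> B = {}"
    "A \<inter> B \<noteq> {} \<Longrightarrow> length ws = 1"
proof -
  define walk where "walk ws \<longleftrightarrow> ws \<noteq> [] \<and> successively (adj E) ws \<and> hd ws \<in> A \<and> last ws \<in> B" for ws
  obtain a b where ab: "a \<in> A" "b \<in> B" using assms(4,5) by blast
  then obtain ws where "ws \<noteq> []" "successively (adj E) ws" "hd ws = a" "last ws = b"
    using connected_graph_walk[OF assms(1), of a b] assms(2,3) by blast
  then have "\<exists>ws. walk ws" using ab by (auto simp: walk_def)
  then obtain ws where ws: "walk ws" and min: "\<And>us. walk us \<Longrightarrow> length ws \<le> length us"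
    using ex_has_least_nat[of walk _ length] by blast
  show ?thesis
  proof (rule that[of ws])
    show "distinct ws"
    proof (rule ccontr)
      assume "\<not> distinct ws"
      then obtain xs ys zs y where eq: "ws = xs @ [y] @ ys @ [y] @ zs" by (metis not_distinct_decomp)
      have "walk (xs @ y # zs)"
        using ws unfolding eq walk_def
        by (cases xs) (auto simp: successively_append_iff successively_Cons hd_append)
      from min[OF this] show False unfolding eq by simp
    qed
    show "set (tl ws) \<inter> A = {}"
    proof (rule ccontr)
      assume "set (tl ws) \<inter> A \<noteq> {}"
      then obtain x where "x \<in> set (tl ws)" "x \<in> A" by blast
      then obtain w ps qs where eq: "ws = (w # ps) @ x # qs" by (cases ws) (auto dest: split_list)
      have "walk (x # qs)"
        using ws \<open>x \<in> A\<close> unfolding eq walk_def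
        by (auto simp: successively_append_iff simp del: append_Cons)
      from min[OF this] show False unfolding eq by simp
    qed
    show "set (butlast ws) \<inter> B = {}"
    proof (rule ccontr)
      assume "set (butlast ws) \<inter> B \<noteq> {}"
      then obtain x where "x \<in> set (butlast ws)" "x \<in> B" by blast
      then obtain w ps qs where eq: "ws = (ps @ [x]) @ qs @ [w]"
        by (cases ws rule: rev_cases) (auto dest: split_list)
      have "walk (ps @ [x])"
        using ws \<open>x \<in> B\<close> unfolding eq walk_def
        by (cases ps) (auto simp: successively_append_iff successively_Cons hd_append)
      from min[OF this] show False unfolding eq by simp
    qed
    show "length ws = 1" if "A \<inter> B \<noteq> {}"
    proof -
      from that obtain x where "x \<in> A" "x \<in> B" by blast
      then have "walk [x]" by (simp add: walk_def)
      from min[OF this] show ?thesis using ws by (cases ws) (auto simp: walk_def)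
    qed
  qed (use ws in \<open>auto simp: walk_def\<close>)
qed

text \<open>A shortest walk between the two edges is prolonged by both of them. If this closed up, then the
edges would share a vertex, the shortest walk would have a single vertex, and the edges would coincide.\<close>

lemma walk_joining_edges:
  assumes "connected_graph V E" "e \<in> E" "e' \<in> E" "e \<noteq> e'"
  obtains a ws d where "ws \<noteq> []" "e = {a, hd ws}" "e' = {last ws, d}"
    "successively (adj E) (a # ws @ [d])" "distinct (a # ws @ [d])"
proof -
  have e: "e \<subseteq> V" "card e = 2" "e' \<subseteq> V" "card e' = 2"
    using assms by (auto simp: connected_graph_def simple_graph_def)
  then have "e \<noteq> {}" "e' \<noteq> {}" by auto
  then obtain ws where ws: "ws \<noteq> []" "successively (adj E) ws" "hd ws \<in> e" "last ws \<in> e'" "distinct ws"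
      "set (tl ws) \<inter> e = {}" "set (butlast ws) \<inter> e' = {}" "e \<inter> e' \<noteq> {} \<Longrightarrow> length ws = 1"
    using shortest_walk[OF assms(1) e(1,3)] by metis
  obtain a where a: "e = {a, hd ws}" "a \<noteq> hd ws" using e(2) ws(3) by (auto simp: card_2_iff)
  obtain d where d: "e' = {last ws, d}" "d \<noteq> last ws" using e(4) ws(4) by (auto simp: card_2_iff)
  have "a \<notin> set ws" using ws(1,6) a by (cases ws) auto
  have "d \<notin> set ws" using ws(1,7) d by (cases ws rule: rev_cases) auto
  have "a \<noteq> d"
  proof
    assume "a = d"
    then have "length ws = 1" using ws(8) a d by auto
    then have "hd ws = last ws" by (cases ws) auto
    then show False using assms(4) a d \<open>a = d\<close> by auto
  qed
  moreover have "adj E a (hd ws)" "adj E (last ws) d" using assms(2,3) a d by (auto simp: adj_def)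
  ultimately show ?thesis
    using that[of ws a d] ws a d \<open>a \<notin> set ws\<close> \<open>d \<notin> set ws\<close>
    by (auto simp: successively_append_iff successively_Cons)
qed

section \<open>The isometric embedding\<close>

lemma point_on_edge:
  assumes "connected_graph V E" "E \<noteq> {}" "p \<in> realization V E"
  obtains e where "e \<in> E" "p \<in> simplex_on e"
proof -
  have s: "simple_graph V E" using assms(1) by (simp add: connected_graph_def)
  obtain c where c: "c \<in> cells V E" "p \<in> simplex_on c" using assms(3) by (auto simp: realization_def)
  from s c(1) show ?thesis
  proof (cases rule: cells_cases)
    case (1 v)
    obtain e where e: "e \<in> E" using assms(2) by blast
    then have "e \<subseteq> V" "card e = 2" using s by (auto simp: simple_graph_def)
    then obtain u where u: "u \<in> V" "u \<noteq> v" by (auto simp: card_2_iff)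
    then have "(adj E)\<^sup>*\<^sup>* v u" using assms(1) 1 by (simp add: connected_graph_def)
    then obtain w where "adj E v w" using u(2) by (cases rule: converse_rtranclpE) auto
    then have "{v, w} \<in> E" "p \<in> simplex_on {v, w}"
      using edge_cell(1)[OF s] c(2) 1 by (auto simp: adj_def simplex_singleton)
    then show ?thesis by (rule that)
  next
    case (2 a b)
    then show ?thesis using that c(2) by blast
  qed
qed

lemma realization_no_edges:
  assumes "connected_graph V {}" "p \<in> realization V {}" "q \<in> realization V {}"
  shows "p = q"
proof -
  have "u = v" if "u \<in> V" "v \<in> V" for u v
  proof -
    have "(adj {})\<^sup>*\<^sup>* u v" using assms(1) that by (simp add: connected_graph_def)
    then show ?thesis by (cases rule: converse_rtranclpE) (auto simp: adj_def)
  qed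
  then show ?thesis using assms(2,3) by (auto simp: realization_def cells_def simplex_singleton)
qed

lemma path_dist_along_walk:
  assumes "connected_graph V E" "ws \<noteq> []" "successively (adj E) (a # ws @ [d])"
    and "p \<in> simplex_on {a, hd ws}" "q \<in> simplex_on {last ws, d}"
  shows "path_dist V E p q \<le> p a + real (length ws - 1) + q d"
proof -
  have s: "simple_graph V E" using assms(1) by (simp add: connected_graph_def)
  have adj: "adj E a (hd ws)" "adj E (last ws) d" "successively (adj E) ws"
    using assms(2,3) by (auto simp: successively_append_iff successively_Cons)
  note e = edge_cell[OF s adj(1)] and e' = edge_cell[OF s adj(2)]
  interpret Metric_space "realization V E" "path_dist V E"
    by (rule Metric_space_path_dist[OF assms(1)])
  have real: "p \<in> realization V E" "q \<in> realization V E"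
    "vertex (hd ws) \<in> realization V E" "vertex (last ws) \<in> realization V E"
    using assms(4,5) e e' by (auto simp: realization_def vertex_in_realization)
  have coords: "0 \<le> p a" "p a + p (hd ws) = 1" "0 \<le> q d" "q (last ws) + q d = 1"
    using assms(4,5) e(6) e'(6) by (auto simp: simplex_on_def)
  have "seg_length p (vertex (hd ws)) = p a"
    using seg_length_edge[OF assms(4) e(2,6)] coords e(6) by (simp add: vertex_def)
  then have "path_dist V E p (vertex (hd ws)) \<le> p a"
    using path_dist_le_seg_length[OF e(3) assms(4) e(2)] by simp
  moreover have "seg_length (vertex (last ws)) q = \<bar>1 - q (last ws)\<bar>"
    using seg_length_edge[OF e'(1) assms(5) e'(6)] by (simp add: vertex_def)
  then have "path_dist V E (vertex (last ws)) q \<le> q d"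
    using path_dist_le_seg_length[OF e'(3,1) assms(5)] coords by simp
  moreover have "path_dist V E (vertex (hd ws)) (vertex (last ws)) \<le> real (length ws - 1)"
    using pl_path_relpowp[OF s e(5) walk_relpowp[OF adj(3) assms(2)]] path_dist_le by metis
  ultimately show ?thesis
    using triangle[OF real(1,3,2)] triangle[OF real(3,4,2)] by linarith
qed

context
  fixes V :: "'v set" and E :: "'v set set" and V' :: "'w set" and E' :: "'w set set"
    and F :: "'v \<Rightarrow> 'w"
  assumes graph: "connected_graph V E" and graph': "connected_graph V' E'"
    and F_vertex: "F ` V \<subseteq> V'"
    and F_edge: "\<And>u v. adj E u v \<Longrightarrow> adj E' (F u) (F v)"
    and F_walk: "\<And>ws. ws \<noteq> [] \<Longrightarrow> set ws \<subseteq> V \<Longrightarrow> successively (adj E) ws \<Longrightarrow> distinct ws \<Longrightarrow>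
      real (length ws - 1) \<le> path_dist V' E' (vertex (F (hd ws))) (vertex (F (last ws)))"
begin

lemma inj_on_vertices: "inj_on F V"
proof (rule inj_onI, rule ccontr)
  fix u v assume uv: "u \<in> V" "v \<in> V" "F u = F v" "u \<noteq> v"
  interpret Metric_space "realization V' E'" "path_dist V' E'"
    by (rule Metric_space_path_dist[OF graph'])
  have s: "simple_graph V E" using graph by (simp add: connected_graph_def)
  obtain ws where ws: "ws \<noteq> []" "successively (adj E) ws" "hd ws = u" "last ws = v" "distinct ws"
    using shortest_walk[OF graph, of "{u}" "{v}"] uv by auto
  have "set ws \<subseteq> V" using walk_in_vertices[OF s ws(2)] ws(3) uv(1) by simp
  then have "real (length ws - 1) \<le> path_dist V' E' (vertex (F u)) (vertex (F v))"
    using F_walk[of ws] ws by simp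
  also have "\<dots> = 0" using uv F_vertex by (simp add: image_subset_iff vertex_in_realization)
  finally have "length ws = 1" using ws(1) by (cases ws) auto
  then show False using ws(3,4) uv(4) by (cases ws) auto
qed

text \<open>Pushing forward polygonal paths shows that distances do not grow. In the other direction, let \<open>p\<close> and
\<open>q\<close> lie on different edges, and let \<open>a, b, \<dots>, c, d\<close> be a path that starts with the edge of \<open>p\<close> and
ends with the edge of \<open>q\<close>. The distance from \<open>F a\<close> on vertices, interpolated affinely over the edges,
is a 1-Lipschitz function on the target. By the assumption on walks it increases between the images
of \<open>p\<close> and \<open>q\<close> by at least the length of the way from \<open>p\<close> over \<open>b\<close> and \<open>c\<close> to \<open>q\<close>.\<close>

lemma path_dist_push:
  assumes "p \<in> realization V E" "q \<in> realization V E"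
  shows "path_dist V' E' (push V F p) (push V F q) = path_dist V E p q"
proof (rule antisym)
  note push = push_in_realization[OF graph inj_on_vertices F_vertex F_edge]
  have s: "simple_graph V E" using graph by (simp add: connected_graph_def)
  have s': "simple_graph V' E'" using graph' by (simp add: connected_graph_def)
  interpret T: Metric_space "realization V E" "path_dist V E"
    by (rule Metric_space_path_dist[OF graph])
  interpret C: Metric_space "realization V' E'" "path_dist V' E'"
    by (rule Metric_space_path_dist[OF graph'])
  show "path_dist V' E' (push V F p) (push V F q) \<le> path_dist V E p q"
    by (rule path_dist_push_le[OF graph inj_on_vertices F_vertex F_edge assms])
  show "path_dist V E p q \<le> path_dist V' E' (push V F p) (push V F q)"
  proof (cases "p = q")
    case True
    then show ?thesis using assms push by simp
  next
    case False
    then have "E \<noteq> {}" using realization_no_edges graph assms by blast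
    then obtain e e' where e: "e \<in> E" "p \<in> simplex_on e" and e': "e' \<in> E" "q \<in> simplex_on e'"
      using point_on_edge[OF graph] assms by metis
    show ?thesis
    proof (cases "e = e'")
      case True
      have "e \<subseteq> V" "card e = 2" using s e(1) by (auto simp: simple_graph_def)
      then obtain a b where ab: "e = {a, b}" "a \<noteq> b" "a \<in> V" by (auto simp: card_2_iff)
      have "path_dist V E p q \<le> seg_length p q"
        using path_dist_le_seg_length[of e V E p q] e e' True by (simp add: cells_def)
      also have "\<dots> = \<bar>push V F p (F a) - push V F q (F a)\<bar>"
        using seg_length_edge[of p a b q] ab e e' True push_apply[OF inj_on_vertices ab(3)] by simp
      also have "\<dots> \<le> path_dist V' E' (push V F p) (push V F q)"
        by (rule coord_le_path_dist[OF graph' push[OF _ assms(1)] push[OF _ assms(2)]])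
      finally show ?thesis .
    next
      case False
      obtain a ws d where ws: "ws \<noteq> []" "e = {a, hd ws}" "e' = {last ws, d}"
          "successively (adj E) (a # ws @ [d])" "distinct (a # ws @ [d])"
        using walk_joining_edges[OF graph e(1) e'(1) False] by metis
      define b where "b = hd ws"
      define c where "c = last ws"
      have adj: "adj E a b" "adj E c d" using e(1) e'(1) ws by (auto simp: adj_def b_def c_def)
      have in_V: "set (a # ws @ [d]) \<subseteq> V"
        by (rule walk_in_vertices[OF s ws(4)]) (use edge_cell(4)[OF s adj(1)] in simp)
      have V: "a \<in> V" "b \<in> V" "c \<in> V" "d \<in> V" using edge_cell(4,5)[OF s] adj by auto
      have ne: "F a \<noteq> F b" "F c \<noteq> F d"
        using edge_cell(6)[OF s] adj V inj_on_vertices by (auto dest: inj_onD)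
      define D where "D g = path_dist V' E' (vertex (F a)) (vertex g)" for g
      have real: "vertex (F v) \<in> realization V' E'" if "v \<in> V" for v
        using that F_vertex by (auto intro: vertex_in_realization)
      have step: "path_dist V' E' (vertex g) (vertex h) \<le> 1" if "adj E' g h" for g h
      proof -
        note f = edge_cell[OF s' that]
        show ?thesis
          using path_dist_le_seg_length[OF f(3,1,2)] seg_length_edge[OF f(1,2,6)] f(6)
          by (simp add: vertex_def)
      qed
      have D_lipschitz: "\<bar>D g - D h\<bar> \<le> 1" if "adj E' g h" for g h
      proof -
        have "vertex g \<in> realization V' E'" "vertex h \<in> realization V' E'"
          using edge_cell(4,5)[OF s' that] by (auto intro: vertex_in_realization)
        then show ?thesis
          using C.triangle[OF real[OF V(1)], of "vertex g" "vertex h"]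
            C.triangle[OF real[OF V(1)], of "vertex h" "vertex g"] step[OF that]
            C.commute[of "vertex g" "vertex h"] by (simp add: D_def)
      qed
      have D_a: "D (F a) = 0" using real[OF V(1)] by (simp add: D_def)
      have D_b: "D (F b) \<le> 1" using step[OF F_edge[OF adj(1)]] by (simp add: D_def)
      define m where "m = length ws - 1"
      have D_c: "real m + 1 \<le> D (F c)"
        using F_walk[of "a # ws"] successively_append_iff[of "adj E" "a # ws" "[d]"] ws in_V
        by (cases ws) (auto simp: D_def c_def m_def)
      have D_d: "real m + 2 \<le> D (F d)"
        using F_walk[of "a # ws @ [d]"] ws in_V by (cases ws) (auto simp: D_def m_def)
      have p: "p \<in> simplex_on {a, b}" and q: "q \<in> simplex_on {c, d}"
        using e(2) e'(2) ws by (auto simp: b_def c_def)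
      have p_sum: "p a + p b = 1" "0 \<le> p b" and q_sum: "q c + q d = 1" "0 \<le> q c" "0 \<le> q d"
        using p q edge_cell(6)[OF s adj(1)] edge_cell(6)[OF s adj(2)] by (auto simp: simplex_on_def)
      have push_simplex: "push V F p \<in> simplex_on {F a, F b}" "push V F q \<in> simplex_on {F c, F d}"
        using push_in_simplex[OF inj_on_vertices _ p] push_in_simplex[OF inj_on_vertices _ q] V by auto
      have Ip: "interpolation D (push V F p) = p b * D (F b)"
        using interpolation_edge[OF push_simplex(1) ne(1)] V D_a by (simp add: push_apply[OF inj_on_vertices])
      have Iq: "interpolation D (push V F q) = q c * D (F c) + q d * D (F d)"
        using interpolation_edge[OF push_simplex(2) ne(2)] V by (simp add: push_apply[OF inj_on_vertices])
      have "path_dist V E p q \<le> p a + real m + q d"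
        using path_dist_along_walk[OF graph ws(1,4)] e(2) e'(2) ws(2,3) by (simp add: m_def)
      also have "\<dots> = q c * (real m + 1) + q d * (real m + 2) - p b * 1"
      proof -
        have eq: "p a = 1 - p b" "q c = 1 - q d" using p_sum q_sum by auto
        show ?thesis unfolding eq by (simp add: algebra_simps)
      qed
      also have "\<dots> \<le> interpolation D (push V F q) - interpolation D (push V F p)"
        unfolding Ip Iq using D_b D_c D_d p_sum q_sum by (intro diff_mono add_mono mult_left_mono)
      also have "\<dots> \<le> path_dist V' E' (push V F p) (push V F q)"
        using interpolation_lipschitz[of V' E' D, OF graph' D_lipschitz push[OF _ assms(1)] push[OF _ assms(2)]] by simp
      finally show ?thesis .
    qed
  qed
qed

end

theorem theorem1p4:
  fixes V :: "'v set" and E :: "'v set set"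
  assumes "tree_graph V E"
    and "locally_compact_space (Metric_space.mtopology (realization V E) (path_dist V E))"
  shows "\<exists>f \<in> realization V E \<rightarrow> realization (carrier F2) (biinv_cayley_edges F2 F2_gens).
           (\<forall>p \<in> realization V E. \<forall>q \<in> realization V E.
              path_dist (carrier F2) (biinv_cayley_edges F2 F2_gens) (f p) (f q) = path_dist V E p q) \<and>
           (\<forall>v \<in> V. f (vertex v) \<in> vertex ` carrier F2)"
proof -
  have graph: "connected_graph V E" using assms(1) by (simp add: tree_graph_def)
  have s: "simple_graph V E" using graph by (simp add: connected_graph_def)
  have "countable V"
    using locally_finite_imp_countable[OF graph] locally_compact_imp_locally_finite[OF graph assms(2)] by blast
  then obtain F where F: "\<And>v. v \<in> V \<Longrightarrow> F v \<in> carrier F2"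
    and edge: "\<And>u v. adj E u v \<Longrightarrow> F u \<otimes>\<^bsub>F2\<^esub> inv\<^bsub>F2\<^esub> (F v) \<in> conj_closure F2 F2_gens"
    and walk: "\<And>ws. ws \<noteq> [] \<Longrightarrow> set ws \<subseteq> V \<Longrightarrow> successively (adj E) ws \<Longrightarrow> distinct ws \<Longrightarrow>
      length ws - 1 \<le> biinv_dist F2 F2_gens (F (hd ws)) (F (last ws))"
    using countable_tree_vertex_embedding[OF assms(1)] by metis
  have F_vertex: "F ` V \<subseteq> carrier F2" using F by blast
  have F_edge: "adj (biinv_cayley_edges F2 F2_gens) (F u) (F v)" if "adj E u v" for u v
    using F2.adj_cayley_iff[OF F2_gens_closed F2_gens_inv] edge[OF that] F edge_cell(4,5)[OF s that] by blast
  have F_walk: "real (length ws - 1) \<le> path_dist (carrier F2) (biinv_cayley_edges F2 F2_gens)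
      (vertex (F (hd ws))) (vertex (F (last ws)))"
    if "ws \<noteq> []" "set ws \<subseteq> V" "successively (adj E) ws" "distinct ws" for ws
  proof -
    have "hd ws \<in> V" "last ws \<in> V" using that by (auto simp: subset_iff)
    then show ?thesis using path_dist_F2_cayley[OF F F] walk[OF that] by simp
  qed
  note embedding = graph connected_F2_cayley F_vertex F_edge F_walk
  have inj: "inj_on F V" by (rule inj_on_vertices[OF embedding])
  show ?thesis
  proof (intro bexI[of _ "push V F"] conjI ballI)
    show "path_dist (carrier F2) (biinv_cayley_edges F2 F2_gens) (push V F p) (push V F q) = path_dist V E p q"
      if "p \<in> realization V E" "q \<in> realization V E" for p q
      by (rule path_dist_push[OF embedding that])
    show "push V F (vertex v) \<in> vertex ` carrier F2" if "v \<in> V" for v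
      using push_vertex[OF inj that] F[OF that] by simp
    show "push V F \<in> realization V E \<rightarrow> realization (carrier F2) (biinv_cayley_edges F2 F2_gens)"
      by (intro Pi_I push_in_realization[OF graph inj F_vertex F_edge])
  qed
qed

end
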